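(* Let $\mathcal{C}\subset\mathbb{R}^2$ be a piecewise $C^1$ curve of finite length with a piecewise bilipschitz continuous unit tangent vector. Let $K_n$ denote the $n$th generation of the four-corner Cantor set. Then there are constants $n_0\in\mathbb{N}$ and $c<\infty$, depending only on $\mathcal{C}$, such that for all $n\ge n_0$, $$\mathrm{Fav}_{\mathcal{C}}(K_n)\le c\,(\log_* n)^{-1/100}.$$
   Context: $|\cdot|$ denotes Lebesgue measure. Four-corner Cantor set: $C_0=[0,1]$ and, for $n\in\mathbb{N}$, $C_n=\bigcup_{a_1,\dots,a_n\in\{0,3\}}\left[\sum_{j=1}^n a_j4^{-j},\ \sum_{j=1}^n a_j4^{-j}+4^{-n}\right]$; then $K_n=C_n\times C_n\subset[0,1]^2$. Inverse tower function: $\log_* x=\min\{m\ge0:\log^{(m)}x\le1\}$, where $\log^{(m)}$ is the $m$-fold iterated logarithm. Curve: $\mathcal{C}$ is a finite concatenation of $C^1$ arcs of finite length such that on each arc, parametrized by arclength as $\gamma$, the unit tangent is bilipschitz: there is $\Lambda\ge1$ with $\Lambda^{-1}|s-t|\le|\gamma'(s)-\gamma'(t)|\le\Lambda|s-t|$. Such a curve is a finite union of pieces of the form $\{t\omega_1+\varphi(t)\omega_2:t\in I\}$ with $(\omega_1,\omega_2)$ orthonormal, $I$ a bounded interval, $\varphi$ of class $C^1$ and $\varphi'$ bilipschitz. Favard curve length: $\mathrm{Fav}_{\mathcal{C}}(E)=\left|\{(\alpha,\beta)\in\mathbb{R}^2:\ ((\alpha,\beta)+\mathcal{C})\cap E\neq\emptyset\}\right|$.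 *)

theory Defs
  imports "HOL-Analysis.Analysis"
begin

(* For n = 0 the only admissible digit function is undefined everywhere, the sum is empty,
   and the formula gives {0..1}. *)
definition cantor_stage :: "nat \<Rightarrow> real set" where
  "cantor_stage n =
     (\<Union>a \<in> {1..n} \<rightarrow>\<^sub>E {0, 3}.
        {(\<Sum>j=1..n. a j / 4 ^ j) .. (\<Sum>j=1..n. a j / 4 ^ j) + 1 / 4 ^ n})"

definition four_corner_cantor :: "nat \<Rightarrow> (real \<times> real) set" where
  "four_corner_cantor n = cantor_stage n \<times> cantor_stage n"

(* The value of ln outside the positive reals never matters: all iterates before the first one
   that is at most 1 exceed 1. *)
definition log_star :: "real \<Rightarrow> nat" where
  "log_star x = (LEAST m. (ln ^^ m) x \<le> 1)"

(* The derivative at the endpoints is one-sided, and norm (g' t) = 1 says that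
   g is an arclength parametrization. The arc need not be injective. *)
definition bilipschitz_tangent_arc :: "real \<Rightarrow> real \<Rightarrow> (real \<Rightarrow> real \<times> real) \<Rightarrow> bool" where
  "bilipschitz_tangent_arc a b g \<longleftrightarrow>
     a < b \<and>
     (\<exists>g'. (\<forall>t\<in>{a..b}. (g has_vector_derivative g' t) (at t within {a..b}) \<and> norm (g' t) = 1) \<and>
           continuous_on {a..b} g' \<and>
           (\<exists>\<Lambda>\<ge>1. \<forall>s\<in>{a..b}. \<forall>t\<in>{a..b}.
               \<bar>s - t\<bar> / \<Lambda> \<le> norm (g' s - g' t) \<and> norm (g' s - g' t) \<le> \<Lambda> * \<bar>s - t\<bar>))"

(* A finite concatenation is given by one arclength parametrization g of the whole curve on
   {p 0..p N} and breakpoints p 0 < ... < p N; consecutive arcs share an endpoint, but the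
   tangent may jump there. The length is p N - p 0. *)
definition piecewise_bilipschitz_tangent_curve :: "(real \<times> real) set \<Rightarrow> bool" where
  "piecewise_bilipschitz_tangent_curve C \<longleftrightarrow>
     (\<exists>g p N. 1 \<le> N \<and>
        (\<forall>i<N. bilipschitz_tangent_arc (p i) (p (Suc i)) g) \<and>
        C = g ` {p 0..p N})"

definition favard_curve_length :: "(real \<times> real) set \<Rightarrow> (real \<times> real) set \<Rightarrow> ennreal" where
  "favard_curve_length C E = emeasure lebesgue {v. ((\<lambda>x. v + x) ` C) \<inter> E \<noteq> {}}"

end

theory Submission
  imports Defs
begin

text \<open>
  The proof reduces curves to lines and then shows that almost all linear projections of $K_n$ are
  short because squares of $K_n$ pile up above each other.
  
  From curves to lines. Cut an arc into pieces of length $4^{-m}$ and $K_{2m}$ into its $4^m$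
  squares of side $4^{-m}$. The tangent is Lipschitz, so each piece agrees with a segment up to
  $O(4^{-2m})$, which is the side of the smallest squares of $K_{2m}$. Hence the translations that
  move the piece so that it meets a given one of the $4^m$ squares fill, up to a constant, an area
  of $4^{-2m}$ times the length of the projection of $K_m$ along that piece. Because $K_n$ has
  dimension one, there are $4^m$ squares and $O(4^m)$ pieces, so summing over all pairs loses
  nothing: the area of all translations is at most a constant times the average, over the tangent
  directions of the pieces, of the length of the projection of $K_m$ (\<open>area_short_arc\<close>,
  \<open>arc_area\<close>). As the tangent is bilipschitz, the directions of the pieces are separated by a
  constant times $4^{-m}$, so few of them fall into a small set of exceptional directions.
  
  Projections of $K_n$. Call two squares of the same generation close, with error $\varepsilon$, if
  their projections differ by at most $\varepsilon$ times their side. Digit by digit one finds, for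
  every slope and every scale $4^{-k}$, a nearby slope (within $O(4^{-k})$) for which two squares
  of generation $k$ project to exactly the same interval; then the slopes within
  $\varepsilon 4^{-k}$ of it still have a close pair with error $\varepsilon$ (\<open>exists_hole\<close>).
  So the set of slopes without a close pair is porous at every scale, and its measure decays
  exponentially in the number of scales (\<open>card_bad_cells\<close>).
  
  If $K$ squares of generation $k$ have nearly the same projection, then copying them into both
  squares of a close pair with error $4^{-k}$ gives $2K$ such squares (\<open>stack_double\<close>). Iterating
  $p$ times, where each step needs a generation exponential in the preceding one, gives a stack of
  $2^p$ squares. By self-similarity the stacks eventually absorb almost all of $K_n$, and the
  projection has length $O(1/p)$ (\<open>density_saturate\<close>, \<open>density_good_slope\<close>). Since the generation
  that this takes is at most a tower of exponentials of height $3p+2$, one may take $p$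
  proportional to $\log_* n$. This gives the bound $O(1/\log_* n)$, which is stronger than the asserted power.
\<close>

section \<open>Digit sets\<close>

text \<open>
  \<open>corners k\<close> consists of the left endpoints of the intervals of the $k$-th Cantor stage, scaled
  by $4^k$ to become integers.
\<close>

fun corners :: "nat \<Rightarrow> int set" where
  "corners 0 = {0}"
| "corners (Suc k) = (\<Union>x\<in>corners k. {4 * x, 4 * x + 3})"

lemma corners_bounds: "x \<in> corners k \<Longrightarrow> 0 \<le> x \<and> x < 4 ^ k"
  by (induction k arbitrary: x) fastforce+

lemma corners_bounds_real:
  assumes "x \<in> corners k"
  shows "0 \<le> real_of_int x" "real_of_int x + 1 \<le> 4 ^ k"
proof -
  have "0 \<le> x" "x + 1 \<le> 4 ^ k" using corners_bounds[OF assms] by auto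
  then have "real_of_int (x + 1) \<le> real_of_int (4 ^ k)" by (simp only: of_int_le_iff)
  with \<open>0 \<le> x\<close> show "0 \<le> real_of_int x" "real_of_int x + 1 \<le> 4 ^ k" by simp_all
qed

lemma finite_corners [simp]: "finite (corners k)"
  by (induction k) auto

lemma card_corners: "card (corners k) = 2 ^ k"
proof (induction k)
  case (Suc k)
  have "card (\<Union>x\<in>corners k. {4 * x, 4 * x + 3}) = (\<Sum>x\<in>corners k. card {4 * x, 4 * x + 3})"
  proof (rule card_UN_disjoint)
    show "\<forall>x\<in>corners k. \<forall>y\<in>corners k. x \<noteq> y \<longrightarrow> {4 * x, 4 * x + 3} \<inter> {4 * y, 4 * y + 3} = {}"
    proof (intro ballI impI equals0I)
      fix x y z :: int assume "x \<noteq> y" "z \<in> {4 * x, 4 * x + 3} \<inter> {4 * y, 4 * y + 3}"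
      then have "4 * x = 4 * y \<or> 4 * x = 4 * y + 3 \<or> 4 * x + 3 = 4 * y" by auto
      with \<open>x \<noteq> y\<close> show False by presburger
    qed
  qed auto
  then show ?case using Suc by simp
qed simp

lemma corners_add: "corners (k + n) = (\<lambda>(x, y). 4 ^ n * x + y) ` (corners k \<times> corners n)"
proof (induction n)
  case 0
  then show ?case by force
next
  case (Suc n)
  have "corners (k + Suc n) = (\<Union>z\<in>corners (k + n). {4 * z, 4 * z + 3})"
    by simp
  also have "\<dots> = (\<Union>x\<in>corners k. \<Union>y\<in>corners n. {4 * (4 ^ n * x + y), 4 * (4 ^ n * x + y) + 3})"
    unfolding Suc by (auto simp del: distrib_left_numeral)
  also have "\<dots> = (\<Union>x\<in>corners k. \<Union>y\<in>corners (Suc n). {4 ^ Suc n * x + y})"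
  proof -
    have "(\<Union>y\<in>corners n. {4 * (4 ^ n * x + y), 4 * (4 ^ n * x + y) + 3})
        = (\<Union>y\<in>corners (Suc n). {4 ^ Suc n * x + y})" for x
      by (simp add: algebra_simps insert_commute)
    then show ?thesis by (simp only:)
  qed
  also have "\<dots> = (\<lambda>(x, y). 4 ^ Suc n * x + y) ` (corners k \<times> corners (Suc n))"
    by (auto simp del: corners.simps)
  finally show ?case .
qed

lemma corners_zero: "0 \<in> corners k"
  by (induction k) auto

lemma corners_mono:
  assumes "k \<le> l"
  shows "corners k \<subseteq> corners l"
proof
  fix x assume "x \<in> corners k"
  then have "4 ^ k * 0 + x \<in> corners ((l - k) + k)"
    unfolding corners_add using corners_zero by (metis (no_types, lifting) SigmaI case_prod_conv image_eqI)
  then show "x \<in> corners l" using assms by simp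
qed

text \<open>
  The stages decrease, so a point of a late stage is located by the digits of any earlier one.
\<close>

lemma cantor_stage_subset_corners:
  assumes "k \<le> n" "z \<in> cantor_stage n"
  obtains x where "x \<in> corners k" "of_int x \<le> 4 ^ k * z" "4 ^ k * z \<le> of_int x + 1"
proof -
  have sums: "\<exists>x\<in>corners n. (\<Sum>j=1..n. a j / 4 ^ j) = of_int x / 4 ^ n"
    if "\<forall>j\<in>{1..n}. a j \<in> {0, 3}" for a :: "nat \<Rightarrow> real" and n
    using that
  proof (induction n)
    case (Suc n)
    then obtain x where x: "x \<in> corners n" "(\<Sum>j=1..n. a j / 4 ^ j) = of_int x / 4 ^ n"
      by auto
    have "a (Suc n) \<in> {0, 3}" using Suc.prems by auto
    then obtain d :: int where d: "d \<in> {0, 3}" "a (Suc n) = of_int d" by force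
    have "(\<Sum>j=1..Suc n. a j / 4 ^ j) = of_int (4 * x + d) / 4 ^ Suc n"
      using x d by (simp add: field_simps)
    moreover have "4 * x + d \<in> corners (Suc n)" using x d by auto
    ultimately show ?case by blast
  qed simp
  have step: "\<exists>x\<in>corners k. of_int x \<le> 4 ^ k * z \<and> 4 ^ k * z \<le> of_int x + 1"
    if prem: "\<exists>x\<in>corners (Suc k). of_int x \<le> 4 ^ Suc k * z \<and> 4 ^ Suc k * z \<le> of_int x + 1"
    for k and z :: real
  proof -
    obtain x where x: "x \<in> corners (Suc k)" "of_int x \<le> 4 ^ Suc k * z"
        "4 ^ Suc k * z \<le> of_int x + 1"
      using prem by blast
    then obtain y where y: "y \<in> corners k" "x = 4 * y \<or> x = 4 * y + 3" by auto
    then have "of_int y \<le> 4 ^ k * z" "4 ^ k * z \<le> of_int y + 1" using x by auto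
    with y show ?thesis by blast
  qed
  obtain a where a: "a \<in> {1..n} \<rightarrow>\<^sub>E {0, 3}"
      and z: "(\<Sum>j=1..n. a j / 4 ^ j) \<le> z" "z \<le> (\<Sum>j=1..n. a j / 4 ^ j) + 1 / 4 ^ n"
    using assms(2) unfolding cantor_stage_def by auto
  have "\<forall>j\<in>{1..n}. a j \<in> {0, 3}" using a by (auto simp: PiE_def Pi_def)
  then obtain x where x: "x \<in> corners n" "(\<Sum>j=1..n. a j / 4 ^ j) = of_int x / 4 ^ n"
    using sums by blast
  have "\<exists>x\<in>corners n. of_int x \<le> 4 ^ n * z \<and> 4 ^ n * z \<le> of_int x + 1"
  proof (intro bexI[of _ x] conjI)
    have eq: "of_int x = 4 ^ n * (\<Sum>j=1..n. a j / 4 ^ j)" using x(2) by simp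
    show "of_int x \<le> 4 ^ n * z" unfolding eq using z(1) by (intro mult_left_mono) auto
    have "4 ^ n * z \<le> 4 ^ n * ((\<Sum>j=1..n. a j / 4 ^ j) + 1 / 4 ^ n)"
      using z(2) by (intro mult_left_mono) auto
    then show "4 ^ n * z \<le> of_int x + 1" unfolding eq by (simp add: distrib_left)
  qed fact
  with assms(1) have "\<exists>x\<in>corners k. of_int x \<le> 4 ^ k * z \<and> 4 ^ k * z \<le> of_int x + 1"
    by (induction rule: inc_induct) (blast intro: step)+
  then show thesis using that by blast
qed

section \<open>Approximating a slope by quotients of differences of digit sums\<close>

definition corner_diffs :: "nat \<Rightarrow> int set" where
  "corner_diffs k = {x - y | x y. x \<in> corners k \<and> y \<in> corners k}"

lemma corner_diffs_bound: "d \<in> corner_diffs k \<Longrightarrow> \<bar>d\<bar> < 4 ^ k"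
  unfolding corner_diffs_def by (auto dest!: corners_bounds)

lemma corner_diffs_minus: "d \<in> corner_diffs k \<Longrightarrow> - d \<in> corner_diffs k"
  unfolding corner_diffs_def by force

lemma corner_diffs_mono: "k \<le> l \<Longrightarrow> corner_diffs k \<subseteq> corner_diffs l"
  unfolding corner_diffs_def using corners_mono by blast

lemma corner_diffs_append:
  assumes "d \<in> corner_diffs k" "e \<in> {-3, 0, 3}"
  shows "4 * d + e \<in> corner_diffs (Suc k)"
proof -
  obtain x y where d: "d = x - y" "x \<in> corners k" "y \<in> corners k"
    using assms(1) unfolding corner_diffs_def by blast
  consider "e = -3" | "e = 0" | "e = 3" using assms(2) by blast
  then show ?thesis
  proof cases
    case 1
    then show ?thesis unfolding corner_diffs_def using d
      by (intro CollectI exI[of _ "4 * x"] exI[of _ "4 * y + 3"]) auto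
  next
    case 2
    then show ?thesis unfolding corner_diffs_def using d
      by (intro CollectI exI[of _ "4 * x"] exI[of _ "4 * y"]) auto
  next
    case 3
    then show ?thesis unfolding corner_diffs_def using d
      by (intro CollectI exI[of _ "4 * x + 3"] exI[of _ "4 * y"]) auto
  qed
qed

text \<open>
  The intervals of radius $1+t$ around $0$, $3t$, $3-3t$, $3$ and $3+3t$ cover $[0,4+4t]$. The
  only gap that threatens to open is the one between $3t$ and $3-3t$; it stays closed for
  $t\ge 1/8$.
\<close>

lemma greedy_digit_nonneg:
  fixes t y :: real
  assumes "1 / 8 \<le> t" "t \<le> 1" "0 \<le> y" "y \<le> 4 + 4 * t"
  obtains a b :: int where "a \<in> {-3, 0, 3}" "b \<in> {-3, 0, 3}" "\<bar>y + a - t * b\<bar> \<le> 1 + t"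
proof -
  consider "y \<le> 1 + t" | "1 + t \<le> y" "y \<le> 1 + 4 * t" | "1 + 4 * t \<le> y" "y \<le> 4 - 2 * t"
    | "4 - 2 * t \<le> y" "y \<le> 4 + t" | "4 + t \<le> y"
    by linarith
  then show thesis
  proof cases
    case 1 then show thesis using that[of 0 0] assms by simp
  next
    case 2 then show thesis using that[of 0 3] assms by (simp add: abs_le_iff)
  next
    case 3 then show thesis using that[of "-3" "-3"] assms by (simp add: abs_le_iff)
  next
    case 4 then show thesis using that[of "-3" 0] assms by (simp add: abs_le_iff)
  next
    case 5 then show thesis using that[of "-3" 3] assms by (simp add: abs_le_iff)
  qed
qed

lemma greedy_digit:
  fixes t z :: real
  assumes "1 / 8 \<le> t" "t \<le> 1" "\<bar>z\<bar> \<le> 1 + t"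
  obtains a b :: int where "a \<in> {-3, 0, 3}" "b \<in> {-3, 0, 3}" "\<bar>4 * z + a - t * b\<bar> \<le> 1 + t"
proof (cases "0 \<le> z")
  case True
  then show thesis using greedy_digit_nonneg[of t "4 * z"] assms that by auto
next
  case False
  then obtain a b :: int where ab: "a \<in> {-3, 0, 3}" "b \<in> {-3, 0, 3}"
      "\<bar>- 4 * z + a - t * b\<bar> \<le> 1 + t"
    using greedy_digit_nonneg[of t "- 4 * z"] assms by auto
  have "\<bar>4 * z + of_int (- a) - t * of_int (- b)\<bar> = \<bar>- 4 * z + a - t * b\<bar>" by simp
  then show thesis using that[of "- a" "- b"] ab by fastforce
qed

text \<open>
  Long division: $A - tB$ is kept in the interval $[-(1+t),1+t]$ by choosing the next pair of
  digits of $A$ and $B$ greedily. The leading digit of $B$ is $3$, which makes $B$ comparable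
  to $4^k$.
\<close>

lemma corner_quotient_approx_pos:
  fixes t :: real
  assumes "1 / 8 \<le> t" "t \<le> 1"
  shows "\<exists>A\<in>corner_diffs (Suc k). \<exists>B\<in>corner_diffs (Suc k).
           \<bar>A - t * B\<bar> \<le> 1 + t \<and> 2 * 4 ^ k + 1 \<le> real_of_int B"
proof (induction k)
  case 0
  have *: "0 \<in> corner_diffs 0" by (force simp: corner_diffs_def)
  have "0 \<in> corner_diffs (Suc 0)" "3 \<in> corner_diffs (Suc 0)"
    using corner_diffs_append[OF *, of 0] corner_diffs_append[OF *, of 3] by auto
  moreover have "\<bar>0 - t * 3\<bar> \<le> 1 + t \<or> \<bar>3 - t * 3\<bar> \<le> 1 + t"
    using assms by linarith
  ultimately show ?case by force
next
  case (Suc k)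
  then obtain A B where AB: "A \<in> corner_diffs (Suc k)" "B \<in> corner_diffs (Suc k)"
      "\<bar>A - t * B\<bar> \<le> 1 + t" "2 * 4 ^ k + 1 \<le> real_of_int B" by blast
  obtain a b where ab: "a \<in> {-3, 0, 3}" "b \<in> {-3, 0, 3}"
      "\<bar>4 * (A - t * B) + of_int a - t * of_int b\<bar> \<le> 1 + t"
    using greedy_digit[OF assms AB(3)] by blast
  have "\<bar>of_int (4 * A + a) - t * of_int (4 * B + b)\<bar> \<le> 1 + t"
    using ab(3) by (simp add: algebra_simps)
  moreover have "2 * 4 ^ Suc k + 1 \<le> real_of_int (4 * B + b)" using AB(4) ab(2) by auto
  ultimately show ?case
    using corner_diffs_append[OF AB(1) ab(1)] corner_diffs_append[OF AB(2) ab(2)] by blast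
qed

text \<open>
  For small $t$ the greedy step fails, but then $t$ may be replaced by $4t$ at the cost of shifting
  the digits of $B$ by one place.
\<close>

lemma corner_quotient_approx_nonneg:
  fixes t :: real
  assumes "0 \<le> t" "t \<le> 1"
  shows "\<exists>A\<in>corner_diffs (Suc k). \<exists>B\<in>corner_diffs (Suc k).
           \<bar>A - t * B\<bar> \<le> 2 \<and> 2 * 4 ^ k + 1 \<le> real_of_int B"
  using assms
proof (induction k arbitrary: t)
  case (Suc k)
  show ?case
  proof (cases "1 / 8 \<le> t")
    case True
    show ?thesis using corner_quotient_approx_pos[OF True Suc.prems(2), of "Suc k"] Suc.prems by force
  next
    case False
    then obtain A B where AB: "A \<in> corner_diffs (Suc k)" "B \<in> corner_diffs (Suc k)"
      "\<bar>A - (4 * t) * B\<bar> \<le> 2" "2 * 4 ^ k + 1 \<le> real_of_int B" using Suc.IH[of "4 * t"] Suc.prems by force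
    have "4 * B + 0 \<in> corner_diffs (Suc (Suc k))" using AB(2) by (rule corner_diffs_append) simp
    moreover have "A \<in> corner_diffs (Suc (Suc k))" using AB(1) corner_diffs_mono[of "Suc k" "Suc (Suc k)"] by auto
    ultimately show ?thesis using AB(3,4)
      by (intro bexI[of _ A] bexI[of _ "4 * B"]) (auto simp: algebra_simps)
  qed
next
  case 0
  have *: "0 \<in> corner_diffs 0" by (force simp: corner_diffs_def)
  have "0 \<in> corner_diffs (Suc 0)" "3 \<in> corner_diffs (Suc 0)"
    using corner_diffs_append[OF *, of 0] corner_diffs_append[OF *, of 3] by auto
  moreover have "\<bar>0 - t * 3\<bar> \<le> 2 \<or> \<bar>3 - t * 3\<bar> \<le> 2"
    using 0 by linarith
  ultimately show ?case by force
qed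

lemma corner_quotient_approx:
  fixes t :: real
  assumes "\<bar>t\<bar> \<le> 1"
  obtains A B where "A \<in> corner_diffs (Suc k)" "B \<in> corner_diffs (Suc k)"
    "\<bar>A - t * B\<bar> \<le> 2" "2 * 4 ^ k < \<bar>real_of_int B\<bar>"
proof -
  obtain A B where AB: "A \<in> corner_diffs (Suc k)" "B \<in> corner_diffs (Suc k)"
    "\<bar>A - \<bar>t\<bar> * B\<bar> \<le> 2" "2 * 4 ^ k + 1 \<le> real_of_int B"
    using corner_quotient_approx_nonneg[of "\<bar>t\<bar>" k] assms by force
  show thesis
  proof (cases "0 \<le> t")
    case True
    then show thesis using that[OF AB(1,2)] AB by auto
  next
    case False
    then show thesis using that[OF AB(1) corner_diffs_minus[OF AB(2)]] AB by auto
  qed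
qed

section \<open>Almost coinciding projections\<close>

text \<open>
  The coordinate that remains when the plane is projected along lines of slope $t$.
\<close>

definition height :: "real \<Rightarrow> int \<times> int \<Rightarrow> real" where
  "height t v = of_int (snd v) - t * of_int (fst v)"

definition corner_pairs :: "nat \<Rightarrow> (int \<times> int) set" where
  "corner_pairs k = corners k \<times> corners k"

lemma finite_corner_pairs [simp]: "finite (corner_pairs k)"
  by (simp add: corner_pairs_def)

lemma card_corner_pairs: "card (corner_pairs k) = 4 ^ k"
  by (simp add: corner_pairs_def card_cartesian_product card_corners power_mult_distrib[symmetric])

lemma corner_pairs_mono: "k \<le> l \<Longrightarrow> corner_pairs k \<subseteq> corner_pairs l"
  unfolding corner_pairs_def by (intro Sigma_mono corners_mono)

text \<open>
  In the integer scale used here the squares of generation $l$ have side one, so the error is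
  relative to the side of the squares.
\<close>

definition close_pair :: "real \<Rightarrow> nat \<Rightarrow> nat \<Rightarrow> bool" where
  "close_pair t l e \<longleftrightarrow>
     (\<exists>u\<in>corner_pairs l. \<exists>v\<in>corner_pairs l. u \<noteq> v \<and> \<bar>height t u - height t v\<bar> \<le> 1 / 4 ^ e)"

lemma close_pair_mono:
  assumes "close_pair t k e" "k \<le> l"
  shows "close_pair t l e"
  using assms(1) corner_pairs_mono[OF assms(2)] unfolding close_pair_def by blast

text \<open>
  Near the midpoint of an interval of slopes of length $16\cdot 4^{-k}$ there is a quotient $A/B$ of
  two differences of digit sums. For this slope the two squares with difference $(B,A)$ project to the same place, and
  as $|B|\le 4^k$ the error grows no faster than $4^k$ times the change of the slope.
\<close>

lemma exists_hole:
  assumes "-1 \<le> a" "a + 16 / 4 ^ Suc k \<le> 1"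
  obtains t' where "a \<le> t'" "t' < a + 16 / 4 ^ Suc k"
    "\<And>t. \<bar>t - t'\<bar> \<le> 1 / (4 ^ e * 4 ^ Suc k) \<Longrightarrow> close_pair t (Suc k) e"
proof -
  define t0 :: real where "t0 = a + 8 / 4 ^ Suc k"
  have "0 < 8 / (4::real) ^ Suc k" by simp
  then have "\<bar>t0\<bar> \<le> 1" unfolding t0_def using assms by linarith
  then obtain A B where A: "A \<in> corner_diffs (Suc k)" and B: "B \<in> corner_diffs (Suc k)"
      and AB: "\<bar>of_int A - t0 * of_int B\<bar> \<le> 2" "2 * 4 ^ k < \<bar>real_of_int B\<bar>"
    using corner_quotient_approx by blast
  obtain x x' where x: "B = x - x'" "x \<in> corners (Suc k)" "x' \<in> corners (Suc k)"
    using B unfolding corner_diffs_def by blast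
  obtain y y' where y: "A = y - y'" "y \<in> corners (Suc k)" "y' \<in> corners (Suc k)"
    using A unfolding corner_diffs_def by blast
  have Bpos: "0 < \<bar>real_of_int B\<bar>" using AB(2) by (smt (verit) zero_less_power)
  then have B0: "real_of_int B \<noteq> 0" by simp
  define t' where "t' = real_of_int A / real_of_int B"
  have "\<bar>t' - t0\<bar> * \<bar>real_of_int B\<bar> = \<bar>of_int A - t0 * of_int B\<bar>"
    unfolding t'_def using B0 by (simp add: abs_mult[symmetric] left_diff_distrib)
  then have "\<bar>t' - t0\<bar> \<le> 2 / \<bar>real_of_int B\<bar>" using AB(1) Bpos by (simp add: field_simps)
  also have "\<dots> < 2 / (2 * 4 ^ k)" using AB(2) B0 by (intro divide_strict_left_mono) auto
  also have "\<dots> = 4 / 4 ^ Suc k" by simp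
  finally have t': "\<bar>t' - t0\<bar> < 4 / 4 ^ Suc k" .
  show thesis
  proof
    have "0 < 4 / (4::real) ^ Suc k" "8 / (4::real) ^ Suc k = 2 * (4 / 4 ^ Suc k)"
      "16 / (4::real) ^ Suc k = 4 * (4 / 4 ^ Suc k)" by auto
    then show "a \<le> t'" "t' < a + 16 / 4 ^ Suc k"
      using t' unfolding t0_def by linarith+
    fix t assume t: "\<bar>t - t'\<bar> \<le> 1 / (4 ^ e * 4 ^ Suc k)"
    have "real_of_int \<bar>B\<bar> \<le> real_of_int (4 ^ Suc k)"
      using corner_diffs_bound[OF B] by (simp only: of_int_le_iff)
    then have Ble: "\<bar>real_of_int B\<bar> \<le> 4 ^ Suc k" by simp
    have "\<bar>height t (x, y) - height t (x', y')\<bar> = \<bar>of_int A - t * of_int B\<bar>"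
      unfolding height_def x(1) y(1) by (simp add: algebra_simps)
    also have "\<dots> = \<bar>t - t'\<bar> * \<bar>real_of_int B\<bar>"
      unfolding t'_def using B0 by (simp add: abs_mult[symmetric] left_diff_distrib abs_minus_commute)
    also have "\<dots> \<le> 1 / (4 ^ e * 4 ^ Suc k) * 4 ^ Suc k"
      using t Ble by (intro mult_mono) auto
    also have "\<dots> = 1 / 4 ^ e" by simp
    finally have "\<bar>height t (x, y) - height t (x', y')\<bar> \<le> 1 / 4 ^ e" .
    moreover have "(x, y) \<noteq> (x', y')" using B0 x(1) by auto
    ultimately show "close_pair t (Suc k) e"
      unfolding close_pair_def corner_pairs_def using x y
      by (intro bexI[of _ "(x, y)"] bexI[of _ "(x', y')"]) auto
  qed
qed

text \<open>
  Exceptional slopes are counted by the grid cells of length $4^{-m}$ that they meet. Counting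
  cells instead of measuring is what lets the estimate be applied to the finitely many tangent
  directions of a subdivided curve.
\<close>

definition bad_cells :: "nat \<Rightarrow> nat \<Rightarrow> nat \<Rightarrow> int set" where
  "bad_cells l e m = {z. - (4 ^ m) \<le> z \<and> z < 4 ^ m \<and>
     (\<exists>t. of_int z \<le> t * 4 ^ m \<and> t * 4 ^ m \<le> of_int z + 1 \<and> \<not> close_pair t l e)}"

lemma finite_bad_cells [simp]: "finite (bad_cells l e m)"
  unfolding bad_cells_def by (rule finite_subset[of _ "{- (4 ^ m)..4 ^ m}"]) auto

text \<open>
  The centre of the hole lies in one of the $4^w$ subcells; that subcell is no longer than the
  radius of the hole, hence free of exceptional slopes.
\<close>

lemma cell_has_good_child:
  assumes "m + 2 \<le> l" "z \<in> bad_cells l e m" "w = e + 2"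
  obtains r where "0 \<le> r" "r < 4 ^ w" "z * 4 ^ w + r \<notin> bad_cells l e (m + w)"
proof -
  define Q :: real where "Q = 4 ^ m"
  define q :: real where "q = 4 ^ w"
  have Q: "0 < Q" and q: "0 < q" by (simp_all add: Q_def q_def)
  have len: "16 / 4 ^ Suc (Suc m) = 1 / Q" by (simp add: Q_def)
  have hole: "1 / (4 ^ e * 4 ^ Suc (Suc m)) = 1 / (Q * q)"
    by (simp add: Q_def q_def assms(3))
  have z: "- (4 ^ m) \<le> z" "z + 1 \<le> 4 ^ m"
    using assms(2) unfolding bad_cells_def by auto
  have "real_of_int (- (4 ^ m)) \<le> real_of_int z"
    using z(1) by (simp only: of_int_le_iff)
  then have "- 1 \<le> of_int z / Q" using Q by (simp add: field_simps Q_def)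
  moreover have "real_of_int (z + 1) \<le> real_of_int (4 ^ m)"
    using z(2) by (simp only: of_int_le_iff)
  then have "of_int z / Q + 1 / Q \<le> 1" using Q by (simp add: field_simps Q_def)
  ultimately obtain t' where t': "of_int z / Q \<le> t'" "t' < of_int z / Q + 1 / Q"
      "\<And>t. \<bar>t - t'\<bar> \<le> 1 / (Q * q) \<Longrightarrow> close_pair t (Suc (Suc m)) e"
    using exists_hole[of "of_int z / Q" "Suc m" e thesis] unfolding len hole by blast
  define r where "r = \<lfloor>t' * (Q * q)\<rfloor> - z * 4 ^ w"
  have lo: "of_int z \<le> t' * Q" "t' * Q < of_int z + 1"
    using t'(1,2) Q by (simp_all add: field_simps)
  have "of_int (z * 4 ^ w) \<le> t' * (Q * q)"
    using mult_right_mono[OF lo(1), of q] q by (simp add: q_def mult.assoc)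
  then have "0 \<le> r" unfolding r_def by (simp add: le_floor_iff)
  have "t' * (Q * q) < of_int (z * 4 ^ w + 4 ^ w)"
    using mult_strict_right_mono[OF lo(2), of q] q by (simp add: q_def algebra_simps)
  then have "\<lfloor>t' * (Q * q)\<rfloor> < z * 4 ^ w + 4 ^ w" unfolding floor_less_iff .
  then have "r < 4 ^ w" unfolding r_def by simp
  have zr: "z * 4 ^ w + r = \<lfloor>t' * (Q * q)\<rfloor>" unfolding r_def by simp
  have power: "(4::real) ^ (m + w) = Q * q"
    by (simp add: Q_def q_def power_add)
  have "\<lfloor>t' * (Q * q)\<rfloor> \<notin> bad_cells l e (m + w)"
  proof
    assume "\<lfloor>t' * (Q * q)\<rfloor> \<in> bad_cells l e (m + w)"
    then obtain t where t: "of_int \<lfloor>t' * (Q * q)\<rfloor> \<le> t * (Q * q)"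
        "t * (Q * q) \<le> of_int \<lfloor>t' * (Q * q)\<rfloor> + 1" "\<not> close_pair t l e"
      unfolding bad_cells_def mem_Collect_eq power by blast
    have "\<bar>t * (Q * q) - t' * (Q * q)\<bar> \<le> 1"
      using t(1,2) floor_correct[of "t' * (Q * q)"] by linarith
    then have "\<bar>t - t'\<bar> * (Q * q) \<le> 1"
      using Q q by (simp add: left_diff_distrib[symmetric] abs_mult)
    then have "\<bar>t - t'\<bar> \<le> 1 / (Q * q)" using Q q by (simp add: pos_le_divide_eq)
    then have "close_pair t (Suc (Suc m)) e" by (rule t'(3))
    then have "close_pair t l e" by (rule close_pair_mono) (use assms(1) in simp)
    with t(3) show False by simp
  qed
  with zr \<open>0 \<le> r\<close> \<open>r < 4 ^ w\<close> show thesis using that by simp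
qed

lemma bad_cell_parent:
  assumes "z * 4 ^ w + s \<in> bad_cells l e (m + w)" "0 \<le> s" "s < 4 ^ w"
  shows "z \<in> bad_cells l e m"
proof -
  define Q :: real where "Q = 4 ^ m"
  define q :: real where "q = 4 ^ w"
  have Q: "0 < Q" and q: "0 < q" by (simp_all add: Q_def q_def)
  define y where "y = z * 4 ^ w + s"
  have "(4::real) ^ (m + w) = Q * q" "(4::int) ^ (m + w) = 4 ^ m * 4 ^ w"
    by (simp_all add: Q_def q_def power_add)
  then obtain t where t: "of_int y \<le> t * (Q * q)" "t * (Q * q) \<le> of_int y + 1"
      "\<not> close_pair t l e"
    and y: "(- (4 ^ m)) * 4 ^ w \<le> y" "y < 4 ^ m * 4 ^ w"
    using assms(1) unfolding bad_cells_def mem_Collect_eq y_def[symmetric] by auto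
  have bounds: "z * 4 ^ w \<le> y" "y + 1 \<le> (z + 1) * 4 ^ w"
    using assms(2,3) by (simp_all add: y_def distrib_right)
  have "z * 4 ^ w < 4 ^ m * 4 ^ w" using bounds y by linarith
  then have "z < 4 ^ m" by (rule mult_right_less_imp_less) simp
  moreover have "(- (4 ^ m)) * 4 ^ w < (z + 1) * 4 ^ w" using bounds y by linarith
  then have "- (4 ^ m) < z + 1" by (rule mult_right_less_imp_less) simp
  moreover have "of_int z \<le> t * Q"
  proof -
    have "real_of_int (z * 4 ^ w) \<le> of_int y" using bounds(1) by (simp only: of_int_le_iff)
    moreover have "real_of_int (z * 4 ^ w) = of_int z * q" by (simp add: q_def)
    ultimately have "of_int z * q \<le> (t * Q) * q" using t(1) by linarith
    then show ?thesis using q by (rule mult_right_le_imp_le)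
  qed
  moreover have "t * Q \<le> of_int z + 1"
  proof -
    have "real_of_int (y + 1) \<le> of_int ((z + 1) * 4 ^ w)"
      using bounds(2) by (simp only: of_int_le_iff)
    moreover have "real_of_int ((z + 1) * 4 ^ w) = (of_int z + 1) * q" by (simp add: q_def)
    ultimately have "(t * Q) * q \<le> (of_int z + 1) * q" using t(2) by linarith
    then show ?thesis using q by (rule mult_right_le_imp_le)
  qed
  ultimately show ?thesis unfolding bad_cells_def Q_def using t(3) by auto
qed

text \<open>
  Each refinement by the factor $4^w$ loses at least one subcell of every cell, so the proportion of
  bad cells shrinks by the factor $1-4^{-w}$. The two initial cells are those of $[-1,1]$.
\<close>

lemma card_bad_cells:
  assumes "J * w + 2 \<le> l" "w = e + 2"
  shows "card (bad_cells l e (J * w)) \<le> 2 * (4 ^ w - 1) ^ J"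
  using assms(1)
proof (induction J)
  case 0
  have "bad_cells l e 0 \<subseteq> {-1, 0}" unfolding bad_cells_def by auto
  then have "card (bad_cells l e 0) \<le> card {-1, 0 :: int}" by (intro card_mono) auto
  then show ?case by simp
next
  case (Suc J)
  define m where "m = J * w"
  have SucJ: "Suc J * w = m + w" by (simp add: m_def)
  have l: "m + 2 \<le> l" using Suc.prems SucJ by simp
  define q :: int where "q = 4 ^ w"
  have q: "0 < q" by (simp add: q_def)
  have "\<forall>z\<in>bad_cells l e m. \<exists>r. 0 \<le> r \<and> r < q \<and> z * q + r \<notin> bad_cells l e (m + w)"
    using cell_has_good_child[OF l _ assms(2)] unfolding q_def by blast
  from bchoice[OF this] obtain r where r: "\<And>z. z \<in> bad_cells l e m \<Longrightarrow>
      0 \<le> r z \<and> r z < q \<and> z * q + r z \<notin> bad_cells l e (m + w)"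
    by blast
  let ?U = "\<Union>z\<in>bad_cells l e m. (\<lambda>s. z * q + s) ` ({0..<q} - {r z})"
  have "bad_cells l e (m + w) \<subseteq> ?U"
  proof
    fix y assume y: "y \<in> bad_cells l e (m + w)"
    define z s where "z = y div q" and "s = y mod q"
    have ys: "y = z * q + s" "0 \<le> s" "s < q"
      using q by (simp_all add: z_def s_def)
    have z: "z \<in> bad_cells l e m"
      using y ys unfolding q_def by (intro bad_cell_parent[of z w s]) auto
    moreover have "s \<noteq> r z" using r[OF z] y ys by auto
    moreover have "y \<in> (\<lambda>s. z * q + s) ` ({0..<q} - {r z})"
      using ys \<open>s \<noteq> r z\<close> by (intro image_eqI[of _ _ s]) auto
    ultimately show "y \<in> ?U" by blast
  qed
  then have "card (bad_cells l e (m + w)) \<le> card ?U"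
    by (intro card_mono) auto
  also have "\<dots> \<le> (\<Sum>z\<in>bad_cells l e m. card ((\<lambda>s. z * q + s) ` ({0..<q} - {r z})))"
    by (rule card_UN_le) simp
  also have "\<dots> \<le> (\<Sum>z\<in>bad_cells l e m. 4 ^ w - 1)"
  proof (rule sum_mono)
    fix z assume z: "z \<in> bad_cells l e m"
    have "card ((\<lambda>s. z * q + s) ` ({0..<q} - {r z})) \<le> card ({0..<q} - {r z})"
      by (rule card_image_le) simp
    also have "\<dots> = nat q - 1" using r[OF z] by (subst card_Diff_singleton) auto
    also have "nat q = 4 ^ w" unfolding q_def by (simp add: nat_power_eq)
    finally show "card ((\<lambda>s. z * q + s) ` ({0..<q} - {r z})) \<le> 4 ^ w - 1" .
  qed
  also have "\<dots> = card (bad_cells l e m) * (4 ^ w - 1)" by simp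
  also have "\<dots> \<le> 2 * (4 ^ w - 1) ^ J * (4 ^ w - 1)"
    using Suc.IH l by (intro mult_right_mono) (auto simp: m_def)
  finally show ?case unfolding SucJ by (simp add: mult_ac)
qed

section \<open>Stacks of squares\<close>

text \<open>
  The square of generation $k+n$ that sits in the square \<open>u\<close> of generation $k$ in the same way
  as the square \<open>v\<close> of generation $n$ sits in the unit square.
\<close>

definition join :: "nat \<Rightarrow> int \<times> int \<Rightarrow> int \<times> int \<Rightarrow> int \<times> int" where
  "join n u v = (4 ^ n * fst u + fst v, 4 ^ n * snd u + snd v)"

lemma height_join: "height t (join n u v) = 4 ^ n * height t u + height t v"
  by (simp add: height_def join_def algebra_simps)

lemma corner_pairs_add: "corner_pairs (k + n) = (\<lambda>(u, v). join n u v) ` (corner_pairs k \<times> corner_pairs n)"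
  unfolding corner_pairs_def corners_add join_def by force

lemma inj_on_join: "inj_on (\<lambda>(u, v). join n u v) (A \<times> corner_pairs n)"
  unfolding corner_pairs_def
proof (rule inj_onI, clarify)
  fix a b c d a' b' c' d' :: int
  assume cd: "c \<in> corners n" "d \<in> corners n" "c' \<in> corners n" "d' \<in> corners n"
    and eq: "join n (a, b) (c, d) = join n (a', b') (c', d')"
  have unique: "x = x' \<and> y = y'"
    if "y \<in> corners n" "y' \<in> corners n" "4 ^ n * x + y = 4 ^ n * x' + y'" for x y x' y' :: int
  proof -
    have "(4 ^ n * x + y) div 4 ^ n = x" "(4 ^ n * x' + y') div 4 ^ n = x'"
      using corners_bounds[OF that(1)] corners_bounds[OF that(2)] by simp_all
    with that(3) show ?thesis by simp
  qed
  show "(a, b) = (a', b') \<and> (c, d) = (c', d')"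
  proof -
    have "4 ^ n * a + c = 4 ^ n * a' + c'" "4 ^ n * b + d = 4 ^ n * b' + d'"
      using eq by (simp_all add: join_def)
    then show ?thesis using unique[OF cd(1,3)] unique[OF cd(2,4)] by blast
  qed
qed

text \<open>
  The width \<open>D\<close> is measured in sides of the squares, so it is the same for every copy of the stack
  inside a larger square.
\<close>

definition stack :: "real \<Rightarrow> nat \<Rightarrow> nat \<Rightarrow> real \<Rightarrow> bool" where
  "stack t k K D \<longleftrightarrow>
     (\<exists>V\<subseteq>corner_pairs k. card V = K \<and> (\<forall>u\<in>V. \<forall>v\<in>V. \<bar>height t u - height t v\<bar> \<le> D))"

lemma stack_singleton: "stack t k 1 0"
  unfolding stack_def corner_pairs_def using corners_zero by (intro exI[of _ "{(0, 0)}"]) auto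

text \<open>
  The stack is copied into both squares of the close pair. An error of $4^{-k}$ relative to the
  large squares is an error of at most one side of the small squares, so the width of the stack
  grows only by one.
\<close>

lemma stack_double:
  assumes "stack t k K D" "close_pair t l k"
  shows "stack t (l + k) (2 * K) (D + 1)"
proof -
  obtain V where V: "V \<subseteq> corner_pairs k" "card V = K"
      "\<And>u v. u \<in> V \<Longrightarrow> v \<in> V \<Longrightarrow> \<bar>height t u - height t v\<bar> \<le> D"
    using assms(1) unfolding stack_def by blast
  obtain a b where ab: "a \<in> corner_pairs l" "b \<in> corner_pairs l" "a \<noteq> b"
      "\<bar>height t a - height t b\<bar> \<le> 1 / 4 ^ k"
    using assms(2) unfolding close_pair_def by blast
  define W where "W = (\<lambda>(u, v). join k u v) ` ({a, b} \<times> V)"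
  have "W \<subseteq> corner_pairs (l + k)"
    unfolding W_def corner_pairs_add using V(1) ab(1,2) by (intro image_mono) auto
  moreover have "card W = 2 * K"
  proof -
    have "inj_on (\<lambda>(u, v). join k u v) ({a, b} \<times> V)"
      using inj_on_join by (rule inj_on_subset) (use V(1) in auto)
    then show ?thesis unfolding W_def using ab(3) V(2)
      by (simp add: card_image card_cartesian_product)
  qed
  moreover have "\<bar>height t w - height t w'\<bar> \<le> D + 1" if "w \<in> W" "w' \<in> W" for w w'
  proof -
    have split: "\<exists>u\<in>{a, b}. \<exists>v\<in>V. w = join k u v" if mem: "w \<in> W" for w
    proof -
      obtain p where "p \<in> {a, b} \<times> V" "w = join k (fst p) (snd p)"
        using mem unfolding W_def case_prod_beta by blast
      then show ?thesis unfolding mem_Times_iff by (intro bexI) auto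
    qed
    obtain u v where w: "u \<in> {a, b}" "v \<in> V" "w = join k u v"
      using split[OF \<open>w \<in> W\<close>] by (elim bexE)
    obtain u' v' where w': "u' \<in> {a, b}" "v' \<in> V" "w' = join k u' v'"
      using split[OF \<open>w' \<in> W\<close>] by (elim bexE)
    have "\<bar>height t b - height t a\<bar> \<le> 1 / 4 ^ k" using ab(4) by linarith
    then have "\<bar>height t u - height t u'\<bar> \<le> 1 / 4 ^ k"
      using w(1) w'(1) ab(4) by auto
    then have "4 ^ k * \<bar>height t u - height t u'\<bar> \<le> 1" by (simp add: field_simps)
    then have "\<bar>4 ^ k * height t u - 4 ^ k * height t u'\<bar> \<le> 1"
      by (simp add: right_diff_distrib[symmetric] abs_mult)
    moreover have "\<bar>height t v - height t v'\<bar> \<le> D" by (rule V(3)[OF w(2) w'(2)])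
    ultimately show ?thesis unfolding w(3) w'(3) height_join by linarith
  qed
  ultimately show ?thesis unfolding stack_def by (intro exI[of _ W]) simp
qed

section \<open>Measure of the thickened projection\<close>

text \<open>
  The projection of $K_n$, scaled by $4^n$ and fattened by \<open>R\<close> sides of its smallest squares. The
  fattening absorbs the size of these squares and the deviation of a curve from its tangent.
\<close>

definition thick_projection :: "real \<Rightarrow> real \<Rightarrow> nat \<Rightarrow> real set" where
  "thick_projection t R n = (\<Union>w\<in>corner_pairs n. {height t w - R..height t w + R})"

definition density :: "real \<Rightarrow> real \<Rightarrow> nat \<Rightarrow> real" where
  "density t R n = measure lebesgue (thick_projection t R n) / 4 ^ n"

lemma compact_thick_projection: "compact (thick_projection t R n)"
  unfolding thick_projection_def by (intro compact_UN) auto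

lemma lmeasurable_thick_projection [simp]: "thick_projection t R n \<in> lmeasurable"
  by (rule lmeasurable_compact[OF compact_thick_projection])

lemma density_0: "0 \<le> R \<Longrightarrow> density t R 0 = 2 * R"
  by (simp add: density_def thick_projection_def corner_pairs_def height_def)

text \<open>
  The radius $R$ is measured in sides of the smallest squares. That is why self-similarity holds
  with the same $R$ on both sides.
\<close>

lemma thick_projection_add:
  "thick_projection t R (k + n) = (\<Union>v\<in>corner_pairs k. (+) (4 ^ n * height t v) ` thick_projection t R n)"
proof -
  have shift: "(+) c ` {a - R..a + R} = {(c + a) - R..(c + a) + R}" for a c :: real
    by (simp add: add.commute algebra_simps)
  show ?thesis
    unfolding thick_projection_def corner_pairs_add image_UN shift image_Union
    by (rule set_eqI) (simp add: height_join Bex_def split_paired_Ex algebra_simps)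
qed

lemma measure_translates_le:
  assumes "finite A"
  shows "measure lebesgue (\<Union>v\<in>A. (+) (c v) ` thick_projection t R n)
         \<le> card A * measure lebesgue (thick_projection t R n)"
proof -
  have "measure lebesgue (\<Union>v\<in>A. (+) (c v) ` thick_projection t R n)
      \<le> (\<Sum>v\<in>A. measure lebesgue ((+) (c v) ` thick_projection t R n))"
    using assms by (intro measure_UNION_le) (auto intro!: fmeasurableD measurable_translation)
  also have "\<dots> = card A * measure lebesgue (thick_projection t R n)"
    by (simp add: measure_translation)
  finally show ?thesis .
qed

lemma density_antimono:
  assumes "n \<le> m"
  shows "density t R m \<le> density t R n"
proof -
  obtain k where m: "m = k + n" using assms by (metis le_add_diff_inverse2)
  have "measure lebesgue (thick_projection t R m) \<le> 4 ^ k * measure lebesgue (thick_projection t R n)"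
    unfolding m thick_projection_add
    using measure_translates_le[of "corner_pairs k" _ t R n] by (simp add: card_corner_pairs)
  then show ?thesis unfolding density_def m by (simp add: field_simps power_add)
qed

lemma density_nonneg: "0 \<le> density t R n"
  by (simp add: density_def)

lemma abs_height_le:
  assumes "w \<in> corner_pairs n" "\<bar>t\<bar> \<le> 1"
  shows "\<bar>height t w\<bar> \<le> 2 * 4 ^ n"
proof -
  obtain x y where w: "w = (x, y)" "x \<in> corners n" "y \<in> corners n"
    using assms(1) unfolding corner_pairs_def by auto
  have "0 \<le> real_of_int x" "real_of_int x \<le> 4 ^ n" "0 \<le> real_of_int y" "real_of_int y \<le> 4 ^ n"
    using corners_bounds_real[OF w(2)] corners_bounds_real[OF w(3)] by linarith+
  moreover have "\<bar>t * x\<bar> \<le> \<bar>real_of_int x\<bar>" using assms(2) by (simp add: abs_mult mult_left_le_one_le)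
  ultimately show ?thesis unfolding height_def w(1) fst_conv snd_conv
    by linarith
qed

text \<open>
  The $K$ squares of the stack cast their shadows on a single interval whose length is $O(D+R)$
  times their side; only the other $4^k-K$ squares have to be counted separately.
\<close>

lemma density_saturate_step:
  assumes "stack t k K D" "0 < K" "\<bar>t\<bar> \<le> 1" "0 \<le> R"
  shows "density t R (k + n) \<le> (1 - K / 4 ^ k) * density t R n + 2 * (D + 2 + R) / 4 ^ k"
proof -
  let ?T = "thick_projection t R n"
  obtain V where V: "V \<subseteq> corner_pairs k" "card V = K"
      "\<And>u v. u \<in> V \<Longrightarrow> v \<in> V \<Longrightarrow> \<bar>height t u - height t v\<bar> \<le> D"
    using assms(1) unfolding stack_def by blast
  have "finite V" using V(1) by (rule finite_subset) simp
  obtain v0 where v0: "v0 \<in> V" using V(2) assms(2) by (metis all_not_in_conv card.empty less_irrefl)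
  have D0: "0 \<le> D" using V(3)[OF v0 v0] by simp
  define A where "A = (\<Union>v\<in>corner_pairs k - V. (+) (4 ^ n * height t v) ` ?T)"
  define r where "r = 4 ^ n * (D + 2 + R)"
  define I where "I = {4 ^ n * height t v0 - r..4 ^ n * height t v0 + r}"
  have "(+) (4 ^ n * height t v) ` ?T \<subseteq> I" if "v \<in> V" for v
  proof clarify
    fix s assume "s \<in> ?T"
    then obtain w where w: "w \<in> corner_pairs n" "\<bar>s - height t w\<bar> \<le> R"
      unfolding thick_projection_def by (auto simp: abs_le_iff)
    have "4 ^ n * \<bar>height t v - height t v0\<bar> \<le> 4 ^ n * D"
      using V(3)[OF that v0] by simp
    then have "\<bar>4 ^ n * height t v - 4 ^ n * height t v0\<bar> \<le> 4 ^ n * D"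
      by (simp add: right_diff_distrib[symmetric] abs_mult)
    moreover have "R \<le> 4 ^ n * R" using assms(4) by (simp add: mult_le_cancel_right1)
    moreover have "r = 4 ^ n * D + 2 * 4 ^ n + 4 ^ n * R" by (simp add: r_def algebra_simps)
    ultimately show "4 ^ n * height t v + s \<in> I"
      unfolding I_def using w(2) abs_height_le[OF w(1) assms(3)] by (simp add: abs_le_iff)
  qed
  then have "thick_projection t R (k + n) \<subseteq> A \<union> I"
    unfolding thick_projection_add A_def by blast
  moreover have A: "A \<in> lmeasurable"
    unfolding A_def by (intro fmeasurable.finite_UN) (auto intro: measurable_translation)
  moreover have I: "I \<in> lmeasurable" unfolding I_def by simp
  ultimately have "measure lebesgue (thick_projection t R (k + n)) \<le> measure lebesgue (A \<union> I)"
    by (intro measure_mono_fmeasurable) (auto intro: fmeasurableD)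
  also have "\<dots> \<le> measure lebesgue A + measure lebesgue I"
    using A I by (intro measure_Un_le) (auto intro: fmeasurableD)
  also have "\<dots> \<le> (4 ^ k - real K) * measure lebesgue ?T + 2 * r"
  proof -
    have "card (corner_pairs k - V) = 4 ^ k - K"
      using V(1,2) \<open>finite V\<close> by (simp add: card_Diff_subset card_corner_pairs)
    moreover have "K \<le> 4 ^ k" using V card_mono[OF _ V(1)] by (simp add: card_corner_pairs)
    ultimately have "real (card (corner_pairs k - V)) = 4 ^ k - real K" by (simp add: of_nat_diff)
    then have "measure lebesgue A \<le> (4 ^ k - real K) * measure lebesgue ?T"
      unfolding A_def
      using measure_translates_le[of "corner_pairs k - V" "\<lambda>v. 4 ^ n * height t v" t R n] by simp
    moreover have "measure lebesgue I = 2 * r"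
      unfolding I_def using D0 assms(4) by (simp add: r_def)
    ultimately show ?thesis by simp
  qed
  finally have "density t R (k + n) \<le> ((4 ^ k - real K) * measure lebesgue ?T + 2 * r) / 4 ^ (k + n)"
    unfolding density_def by (rule divide_right_mono) simp
  also have "\<dots> = (1 - K / 4 ^ k) * density t R n + 2 * (D + 2 + R) / 4 ^ k"
    unfolding density_def r_def by (simp add: field_simps power_add)
  finally show ?thesis .
qed

text \<open>
  The recursion of the preceding lemma contracts with the factor $1-K4^{-k}$ towards its fixed
  point $2(D+2+R)/K$, starting from the trivial value $2R$.
\<close>

lemma density_saturate:
  assumes "stack t k K D" "0 < K" "\<bar>t\<bar> \<le> 1" "0 \<le> R"
  shows "density t R (M * k) \<le> 2 * (D + 2 + R) / K + (1 - K / 4 ^ k) ^ M * (2 * R)"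
proof (induction M)
  case 0
  have "0 \<le> D"
  proof -
    obtain V where "card V = K" "\<forall>u\<in>V. \<forall>v\<in>V. \<bar>height t u - height t v\<bar> \<le> D"
      using assms(1) unfolding stack_def by blast
    moreover then obtain v where "v \<in> V" using assms(2) by (metis all_not_in_conv card.empty less_irrefl)
    ultimately show ?thesis by fastforce
  qed
  then show ?case using assms(2,4) by (simp add: density_0)
next
  case (Suc M)
  have "K \<le> 4 ^ k"
    using assms(1) card_mono[of "corner_pairs k"] unfolding stack_def
    by (metis card_corner_pairs finite_corner_pairs)
  then have "real K \<le> 4 ^ k" by (metis of_nat_le_iff of_nat_numeral of_nat_power)
  then have q: "0 \<le> 1 - K / (4::real) ^ k" by (simp add: field_simps)
  have "density t R (Suc M * k) \<le> (1 - K / 4 ^ k) * density t R (M * k) + 2 * (D + 2 + R) / 4 ^ k"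
    using density_saturate_step[OF assms, of "M * k"] by simp
  also have "\<dots> \<le> (1 - K / 4 ^ k) * (2 * (D + 2 + R) / K + (1 - K / 4 ^ k) ^ M * (2 * R))
      + 2 * (D + 2 + R) / 4 ^ k"
    using Suc q by (intro add_right_mono mult_left_mono) auto
  also have "\<dots> = 2 * (D + 2 + R) / K + (1 - K / 4 ^ k) ^ Suc M * (2 * R)"
    using assms(2) by (simp add: field_simps)
  finally show ?case .
qed

section \<open>Good slopes\<close>

text \<open>
  A depth at which the slopes without a close pair of error $4^{-k}$ are a proportion of at most
  $e^{-p}$. With $w=k+2$ each group of $w$ scales removes the proportion $4^{-w}$ of the slopes, and
  $p\,4^w$ such groups are used; the summand $2$ is there because the initial cells, of length one, get
  their holes from squares of generation two.
\<close>

definition gap :: "nat \<Rightarrow> nat \<Rightarrow> nat" where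
  "gap p k = p * 4 ^ (k + 2) * (k + 2) + 2"

text \<open>
  The generation of the stack after \<open>i\<close> doublings. It is the same for all slopes, so that the
  exceptional slopes of each step form a single porous set.
\<close>

primrec depth :: "nat \<Rightarrow> nat \<Rightarrow> nat" where
  "depth p 0 = p"
| "depth p (Suc i) = gap p (depth p i) + depth p i"

text \<open>
  Every one of the \<open>p\<close> doublings of the stack succeeds.
\<close>

definition good_slope :: "nat \<Rightarrow> real \<Rightarrow> bool" where
  "good_slope p t \<longleftrightarrow> (\<forall>i<p. close_pair t (gap p (depth p i)) (depth p i))"

text \<open>
  After $p\,4^k$ repetitions of a stack of generation $k$ all but a proportion $e^{-p}$ of the squares
  have been absorbed.
\<close>

definition saturation_level :: "nat \<Rightarrow> nat" where
  "saturation_level p = p * 4 ^ depth p p * depth p p"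

lemma depth_mono: "i \<le> j \<Longrightarrow> depth p i \<le> depth p j"
  by (rule lift_Suc_mono_le) simp_all

lemma gap_le_depth: "i < p \<Longrightarrow> gap p (depth p i) \<le> depth p p"
  using depth_mono[of "Suc i" p p] by simp

lemma stack_depth:
  assumes "\<And>i. i < j \<Longrightarrow> close_pair t (gap p (depth p i)) (depth p i)"
  shows "stack t (depth p j) (2 ^ j) j"
  using assms
proof (induction j)
  case 0
  then show ?case using stack_singleton by simp
next
  case (Suc j)
  then show ?case
    using stack_double[of t "depth p j" "2 ^ j" "real j" "gap p (depth p j)"] by (simp add: add.commute)
qed

lemma power_one_minus_le_exp:
  fixes x :: real
  assumes "1 \<le> x" "p \<ge> 1" "real n = p * x"
  shows "(1 - 1 / x) ^ n \<le> exp (- real p)"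
proof -
  have "0 < real p * x" using assms by (intro mult_pos_pos) auto
  then have "0 < real n" unfolding assms(3) .
  have "(1 - real p / real n) ^ n \<le> exp (- real p)"
  proof (rule exp_ge_one_minus_x_over_n_power_n)
    show "real p \<le> real n" unfolding assms(3) using assms(1) by (simp add: mult_le_cancel_left1)
    show "0 < n" using \<open>0 < real n\<close> by simp
  qed
  moreover have "real p / real n = 1 / x" using assms by (simp add: field_simps)
  ultimately show ?thesis by simp
qed

lemma exp_minus_le: "p \<ge> 1 \<Longrightarrow> exp (- real p) \<le> 1 / p"
proof -
  assume "p \<ge> 1"
  have "real p \<le> exp (real p)" using exp_ge_add_one_self[of "real p"] by linarith
  with \<open>p \<ge> 1\<close> show ?thesis by (simp add: exp_minus field_simps)
qed

lemma times_exp_minus_le: "p \<ge> 1 \<Longrightarrow> real p * exp (- real p) \<le> 4 / p"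
proof -
  assume "p \<ge> 1"
  have "real p / 2 \<le> exp (real p / 2)" using exp_ge_add_one_self[of "real p / 2"] by linarith
  then have "(real p / 2) ^ 2 \<le> exp (real p / 2) ^ 2" by (intro power_mono) auto
  also have "\<dots> = exp (real p)" by (simp add: power2_eq_square exp_add[symmetric])
  finally have "real p * real p \<le> 4 * exp (real p)" by (simp add: power2_eq_square)
  with \<open>p \<ge> 1\<close> show ?thesis by (simp add: exp_minus field_simps)
qed

lemma quadratic_le_power: "p * (p + 2) \<le> 3 * 2 ^ p" for p :: nat
proof (induction p)
  case (Suc p)
  have "2 * p + 3 \<le> 3 * 2 ^ p" by (induction p) auto
  with Suc show ?case by (simp add: algebra_simps)
qed simp

text \<open>
  The stack has $2^p$ squares and width $p$, which contributes about $p\,2^{-p}$; the squares that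
  avoid all stacks contribute $e^{-p}$. Both are $O(1/p)$.
\<close>

lemma density_good_slope:
  assumes "good_slope p t" "\<bar>t\<bar> \<le> 1" "0 \<le> R" "1 \<le> p" "saturation_level p \<le> m"
  shows "density t R m \<le> (6 + 4 * R) / p"
proof -
  define k where "k = depth p p"
  have stack: "stack t k (2 ^ p) p"
    unfolding k_def using assms(1) by (intro stack_depth) (simp add: good_slope_def)
  have "(2::real) ^ p \<le> 2 ^ k" using depth_mono[of 0 p p] by (simp add: k_def)
  also have "\<dots> \<le> 4 ^ k" by (intro power_mono) auto
  finally have "0 \<le> 1 - 2 ^ p / (4::real) ^ k" by (simp add: field_simps)
  moreover have "1 - 2 ^ p / (4::real) ^ k \<le> 1 - 1 / 4 ^ k" by (simp add: divide_right_mono)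
  ultimately have "(1 - 2 ^ p / (4::real) ^ k) ^ (p * 4 ^ k) \<le> (1 - 1 / 4 ^ k) ^ (p * 4 ^ k)"
    by (rule power_mono[rotated])
  also have "\<dots> \<le> exp (- real p)" using assms(4) by (intro power_one_minus_le_exp) auto
  also have "\<dots> \<le> 1 / p" using assms(4) by (rule exp_minus_le)
  finally have small: "(1 - 2 ^ p / (4::real) ^ k) ^ (p * 4 ^ k) \<le> 1 / p" .
  have "real (p * (p + 2)) \<le> real (3 * 2 ^ p)" using quadratic_le_power of_nat_le_iff by blast
  then have "real p * (real p + 2) \<le> 3 * 2 ^ p" by (simp add: algebra_simps)
  moreover have "real p * R \<le> 2 ^ p * R"
    using assms(3) less_exp[of p] by (intro mult_right_mono) (simp_all add: of_nat_less_two_power less_imp_le)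
  ultimately have "2 * (real p + 2 + R) * real p \<le> (6 + 2 * R) * 2 ^ p"
    by (simp add: algebra_simps)
  then have main: "2 * (real p + 2 + R) / 2 ^ p \<le> (6 + 2 * R) / p"
    using assms(4) by (simp add: field_simps)
  have "density t R m \<le> density t R ((p * 4 ^ k) * k)"
    using assms(5) unfolding saturation_level_def k_def by (rule density_antimono)
  also have "\<dots> \<le> 2 * (real p + 2 + R) / real (2 ^ p)
      + (1 - real (2 ^ p) / 4 ^ k) ^ (p * 4 ^ k) * (2 * R)"
    by (rule density_saturate[OF stack _ assms(2,3)]) simp
  also have "\<dots> \<le> (6 + 2 * R) / p + 1 / p * (2 * R)"
    using main small assms(3) by (intro add_mono mult_right_mono) auto
  also have "\<dots> = (6 + 4 * R) / p" by (simp add: add_divide_distrib[symmetric])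
  finally show ?thesis .
qed

lemma card_separated_in_cell:
  fixes \<tau> :: "nat \<Rightarrow> real"
  assumes "finite F" "0 < \<sigma>" "0 \<le> L"
    "\<And>i j. i \<in> F \<Longrightarrow> j \<in> F \<Longrightarrow> i \<le> j \<Longrightarrow> \<sigma> * (real j - real i) \<le> L"
  shows "card F \<le> 1 + L / \<sigma>"
proof (cases "F = {}")
  case False
  let ?a = "Min F" and ?b = "Max F"
  have ab: "?a \<in> F" "?b \<in> F" "?a \<le> ?b" using False assms(1) by auto
  have "card F \<le> card {?a..?b}" using assms(1) by (intro card_mono) auto
  then have "card F \<le> Suc ?b - ?a" by simp
  then have "real (card F) \<le> 1 + (real ?b - real ?a)" using ab(3) by linarith
  moreover have "real ?b - real ?a \<le> L / \<sigma>"
    using assms(4)[OF ab] assms(2) by (simp add: field_simps)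
  ultimately show ?thesis by linarith
qed (use assms in auto)

lemma card_no_close_pair:
  fixes \<tau> :: "nat \<Rightarrow> real"
  assumes "finite I" "0 < \<sigma>"
    and bound: "\<And>i. i \<in> I \<Longrightarrow> \<bar>\<tau> i\<bar> \<le> 1"
    and sep: "\<And>i j. i \<in> I \<Longrightarrow> j \<in> I \<Longrightarrow> i \<le> j \<Longrightarrow> \<sigma> * (real j - real i) \<le> \<bar>\<tau> i - \<tau> j\<bar>"
    and bad: "\<And>i. i \<in> I \<Longrightarrow> \<not> close_pair (\<tau> i) l e"
    and l: "J * w + 2 \<le> l" "w = e + 2"
  shows "card I \<le> 2 * (4 ^ w - 1) ^ J * (1 + 1 / (\<sigma> * 4 ^ (J * w)))"
proof -
  define m where "m = J * w"
  define F where "F z = {i\<in>I. of_int z \<le> \<tau> i * 4 ^ m \<and> \<tau> i * 4 ^ m \<le> of_int z + 1}" for z :: int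
  have finF: "finite (F z)" for z using assms(1) by (simp add: F_def)
  have "I \<subseteq> (\<Union>z\<in>bad_cells l e m. F z)"
  proof
    fix i assume i: "i \<in> I"
    define x where "x = \<tau> i * 4 ^ m"
    have "\<bar>x\<bar> \<le> 4 ^ m" using bound[OF i] by (simp add: x_def abs_mult mult_left_le_one_le)
    then have x: "of_int (- (4 ^ m)) \<le> x" "x \<le> of_int (4 ^ m)" by auto
    obtain z where z: "- (4 ^ m) \<le> z" "z < 4 ^ m" "of_int z \<le> x" "x \<le> of_int z + 1"
    proof (cases "x = of_int (4 ^ m)")
      case True
      have "(0::int) < 4 ^ m" by simp
      then have "- (4 ^ m) \<le> (4 ^ m - 1 :: int)" by linarith
      then show thesis using True that[of "4 ^ m - 1"] by simp
    next
      case False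
      then have "x < of_int (4 ^ m)" using x by linarith
      then show thesis
        using x by (intro that[of "\<lfloor>x\<rfloor>"]) (simp_all only: le_floor_iff floor_less_iff, linarith+)
    qed
    have "z \<in> bad_cells l e m"
      unfolding bad_cells_def using z bad[OF i] unfolding x_def
      by (intro CollectI conjI exI[of _ "\<tau> i"])
    moreover have "i \<in> F z" using z i by (simp add: F_def x_def)
    ultimately show "i \<in> (\<Union>z\<in>bad_cells l e m. F z)" by blast
  qed
  then have "card I \<le> card (\<Union>z\<in>bad_cells l e m. F z)"
    using finF by (intro card_mono) auto
  also have "\<dots> \<le> (\<Sum>z\<in>bad_cells l e m. card (F z))" by (rule card_UN_le) simp
  finally have "real (card I) \<le> (\<Sum>z\<in>bad_cells l e m. real (card (F z)))"
    unfolding of_nat_sum[symmetric] of_nat_le_iff .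
  also have "\<dots> \<le> (\<Sum>z\<in>bad_cells l e m. 1 + (1 / 4 ^ m) / \<sigma>)"
  proof (rule sum_mono)
    fix z
    show "real (card (F z)) \<le> 1 + (1 / 4 ^ m) / \<sigma>"
    proof (rule card_separated_in_cell[OF finF assms(2)])
      fix i j assume ij: "i \<in> F z" "j \<in> F z" "i \<le> j"
      then have "\<bar>\<tau> i * 4 ^ m - \<tau> j * 4 ^ m\<bar> \<le> 1" unfolding F_def mem_Collect_eq by linarith
      then have "\<bar>\<tau> i - \<tau> j\<bar> * 4 ^ m \<le> 1"
        by (simp add: left_diff_distrib[symmetric] abs_mult)
      then have "\<bar>\<tau> i - \<tau> j\<bar> \<le> 1 / 4 ^ m" by (simp add: pos_le_divide_eq)
      with sep[of i j] ij show "\<sigma> * (real j - real i) \<le> 1 / 4 ^ m" by (simp add: F_def)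
    qed simp
  qed
  also have "\<dots> = card (bad_cells l e m) * (1 + 1 / (\<sigma> * 4 ^ m))" by (simp add: field_simps)
  also have "\<dots> \<le> real (2 * (4 ^ w - 1) ^ J) * (1 + 1 / (\<sigma> * 4 ^ m))"
  proof (rule mult_right_mono)
    show "real (card (bad_cells l e m)) \<le> real (2 * (4 ^ w - 1) ^ J)"
      unfolding m_def of_nat_le_iff by (rule card_bad_cells[OF l])
    show "0 \<le> 1 + 1 / (\<sigma> * 4 ^ m)" using assms(2) by simp
  qed
  also have "real (2 * (4 ^ w - 1) ^ J) = 2 * (4 ^ w - 1) ^ J" by (simp add: of_nat_diff)
  finally show ?thesis unfolding m_def .
qed

text \<open>
  Separated slopes occupy each bad cell at most about as often as the length of the cell allows, so
  their number is governed by the total length of the bad cells, which is $O(e^{-p})$ in each of the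
  \<open>p\<close> doubling steps.
\<close>

lemma card_bad_slopes:
  fixes \<tau> :: "nat \<Rightarrow> real"
  assumes "finite I" "1 \<le> S" "1 \<le> p" "depth p p \<le> M"
    and bound: "\<And>i. i \<in> I \<Longrightarrow> \<bar>\<tau> i\<bar> \<le> 1"
    and sep: "\<And>i j. i \<in> I \<Longrightarrow> j \<in> I \<Longrightarrow> i \<le> j \<Longrightarrow> 1 / (S * 4 ^ M) * (real j - real i) \<le> \<bar>\<tau> i - \<tau> j\<bar>"
    and bad: "\<And>i. i \<in> I \<Longrightarrow> \<not> good_slope p (\<tau> i)"
  shows "card I \<le> 16 * S * 4 ^ M / p"
proof -
  define B where "B s = {i\<in>I. \<not> close_pair (\<tau> i) (gap p (depth p s)) (depth p s)}" for s
  have finB: "finite (B s)" for s using assms(1) by (simp add: B_def)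
  have B: "real (card (B s)) \<le> 4 * S * 4 ^ M * exp (- real p)" if s: "s < p" for s
  proof -
    define w where "w = depth p s + 2"
    define J where "J = p * 4 ^ w"
    have gap: "gap p (depth p s) = J * w + 2" by (simp add: gap_def J_def w_def)
    \<comment> \<open>The cells are at least as long as the mesh $4^{-M}$, so the summand one per cell is harmless.\<close>
    have "J * w \<le> M" using gap_le_depth[OF s] assms(4) gap by linarith
    then have JM: "(4::real) ^ (J * w) \<le> 4 ^ M" by (intro power_increasing) auto
    define P :: real where "P = 4 ^ (J * w)"
    have P: "0 < P" by (simp add: P_def)
    have "real (card (B s)) \<le> 2 * (4 ^ w - 1) ^ J * (1 + 1 / (1 / (S * 4 ^ M) * 4 ^ (J * w)))"
    proof (rule card_no_close_pair[where \<tau> = \<tau> and l = "gap p (depth p s)" and e = "depth p s"])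
      show "0 < 1 / (S * 4 ^ M)" using assms(2) by simp
      show "J * w + 2 \<le> gap p (depth p s)" by (simp only: gap)
      show "finite (B s)" by (rule finB)
      show "w = depth p s + 2" by (rule w_def)
    qed (use bound sep in \<open>auto simp: B_def\<close>)
    also have "\<dots> = 2 * (4 ^ w - 1) ^ J * (1 + S * 4 ^ M / P)"
      using assms(2) by (simp add: P_def)
    also have "\<dots> \<le> 2 * (4 ^ w - 1) ^ J * (2 * (S * 4 ^ M / P))"
    proof (rule mult_left_mono)
      have "P \<le> S * 4 ^ M" using mult_mono[OF assms(2) JM] assms(2) by (simp add: P_def)
      then have "1 \<le> S * 4 ^ M / P" using P by (simp add: field_simps)
      then show "1 + S * 4 ^ M / P \<le> 2 * (S * 4 ^ M / P)" by simp
    qed simp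
    also have "\<dots> = 4 * S * 4 ^ M * ((4 ^ w - 1) ^ J / (4 ^ w) ^ J)"
      by (simp add: P_def power_mult[symmetric] mult.commute[of J])
    also have "(4 ^ w - 1) ^ J / (4 ^ w) ^ J = (1 - 1 / (4::real) ^ w) ^ J"
      by (simp add: power_divide[symmetric] diff_divide_distrib)
    also have "4 * S * 4 ^ M * (1 - 1 / (4::real) ^ w) ^ J \<le> 4 * S * 4 ^ M * exp (- real p)"
      using assms(2,3) by (intro mult_left_mono power_one_minus_le_exp) (auto simp: J_def)
    finally show ?thesis .
  qed
  have "I \<subseteq> (\<Union>s<p. B s)" using bad by (auto simp: good_slope_def B_def)
  then have "card I \<le> card (\<Union>s<p. B s)" using finB by (intro card_mono) auto
  also have "\<dots> \<le> (\<Sum>s<p. card (B s))" by (rule card_UN_le) simp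
  finally have "real (card I) \<le> (\<Sum>s<p. real (card (B s)))"
    unfolding of_nat_sum[symmetric] of_nat_le_iff .
  also have "\<dots> \<le> (\<Sum>s<p. 4 * S * 4 ^ M * exp (- real p))"
    by (rule sum_mono) (use B in auto)
  also have "\<dots> = 4 * S * 4 ^ M * (real p * exp (- real p))" by simp
  also have "\<dots> \<le> 4 * S * 4 ^ M * (4 / p)"
    using assms(2,3) by (intro mult_left_mono times_exp_minus_le) auto
  finally show ?thesis by (simp add: field_simps)
qed

section \<open>Areas of sheared strips\<close>

text \<open>
  A bound on the outer measure, which passes to subsets without a proof of measurability.
\<close>

definition area_at_most :: "(real \<times> real) set \<Rightarrow> real \<Rightarrow> bool" where
  "area_at_most X r \<longleftrightarrow> (\<exists>A\<in>sets lebesgue. X \<subseteq> A \<and> emeasure lebesgue A \<le> ennreal r)"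

lemma area_at_most_subset: "area_at_most Y r \<Longrightarrow> X \<subseteq> Y \<Longrightarrow> area_at_most X r"
  unfolding area_at_most_def by blast

lemma area_at_most_mono: "area_at_most X r \<Longrightarrow> r \<le> s \<Longrightarrow> area_at_most X s"
  unfolding area_at_most_def by (meson ennreal_leI order_trans)

lemma area_at_most_UN:
  assumes "finite I" "\<And>i. i \<in> I \<Longrightarrow> 0 \<le> r i" "\<And>i. i \<in> I \<Longrightarrow> area_at_most (X i) (r i)"
  shows "area_at_most (\<Union>i\<in>I. X i) (\<Sum>i\<in>I. r i)"
proof -
  have "\<forall>i\<in>I. \<exists>A. A \<in> sets lebesgue \<and> X i \<subseteq> A \<and> emeasure lebesgue A \<le> ennreal (r i)"
    using assms(3) unfolding area_at_most_def by blast
  from bchoice[OF this] obtain A where A: "\<And>i. i \<in> I \<Longrightarrow> A i \<in> sets lebesgue"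
      "\<And>i. i \<in> I \<Longrightarrow> X i \<subseteq> A i" "\<And>i. i \<in> I \<Longrightarrow> emeasure lebesgue (A i) \<le> ennreal (r i)"
    by blast
  have "emeasure lebesgue (\<Union>i\<in>I. A i) \<le> (\<Sum>i\<in>I. emeasure lebesgue (A i))"
    using A(1) assms(1) by (intro emeasure_subadditive_finite) auto
  also have "\<dots> \<le> (\<Sum>i\<in>I. ennreal (r i))" using A(3) by (rule sum_mono)
  also have "\<dots> = ennreal (\<Sum>i\<in>I. r i)" using assms(2) by (rule sum_ennreal)
  finally have "emeasure lebesgue (\<Union>i\<in>I. A i) \<le> ennreal (\<Sum>i\<in>I. r i)" .
  moreover have "(\<Union>i\<in>I. A i) \<in> sets lebesgue" using A(1) assms(1) by (intro sets.finite_UN) auto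
  moreover have "(\<Union>i\<in>I. X i) \<subseteq> (\<Union>i\<in>I. A i)" using A(2) by (rule UN_mono[OF subset_refl])
  ultimately show ?thesis unfolding area_at_most_def by blast
qed

lemma nn_integral_slices:
  assumes S: "compact S" and "a \<le> b" "0 < \<kappa>"
  shows "(\<integral>\<^sup>+x. emeasure lborel {y. x \<in> {a..b} \<and> \<kappa> * (y - t * x) - c \<in> S} \<partial>lborel)
         = ennreal ((b - a) / \<kappa> * measure lebesgue S)" 
proof -
  have slice: "emeasure lborel {y. x \<in> {a..b} \<and> \<kappa> * (y - t * x) - c \<in> S}
      = ennreal (measure lebesgue S / \<kappa>) * indicator {a..b} x" for x
  proof (cases "x \<in> {a..b}")
    case True
    have eq: "{y. x \<in> {a..b} \<and> \<kappa> * (y - t * x) - c \<in> S}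
        = (\<lambda>s. (1 / \<kappa>) *\<^sub>R s + (c / \<kappa> + t * x)) ` S" (is "?L = ?R")
    proof
      show "?L \<subseteq> ?R"
      proof
        fix y assume "y \<in> ?L"
        then show "y \<in> ?R" using assms(3)
          by (intro image_eqI[of _ _ "\<kappa> * (y - t * x) - c"]) (auto simp: field_simps)
      qed
      show "?R \<subseteq> ?L" using True assms(3) by (auto simp: field_simps)
    qed
    have "compact ?R" using S by (intro compact_continuous_image continuous_intros)
    then have "emeasure lborel ?R = emeasure lebesgue ?R"
      by (simp add: borel_compact)
    also have "\<dots> = ennreal (measure lebesgue ?R)"
      using lmeasurable_compact[OF \<open>compact ?R\<close>] by (simp add: emeasure_eq_measure2)
    also have "measure lebesgue ?R = 1 / \<kappa> * measure lebesgue S"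
      using measure_lebesgue_affine[of "1 / \<kappa>" "c / \<kappa> + t * x" S] assms(3) by simp
    finally show ?thesis unfolding eq using True by simp
  next
    case False
    then have "{y. x \<in> {a..b} \<and> \<kappa> * (y - t * x) - c \<in> S} = {}" by blast
    then have "emeasure lborel {y. x \<in> {a..b} \<and> \<kappa> * (y - t * x) - c \<in> S} = 0"
      by (simp only: emeasure_empty)
    then show ?thesis unfolding indicator_simps(2)[OF False] by simp
  qed
  show ?thesis
    unfolding slice using assms
    by (simp add: nn_integral_cmult_indicator ennreal_mult[symmetric])
qed

text \<open>
  A shear preserves area, by Fubini: all slices of the strip have the same measure.
\<close>

lemma area_strip:
  assumes S: "compact S" and "a \<le> b" "0 < \<kappa>"
  shows "area_at_most {v. fst v \<in> {a..b} \<and> \<kappa> * (snd v - t * fst v) - c \<in> S}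
           ((b - a) / \<kappa> * measure lebesgue S)" (is "area_at_most ?A _")
    and "area_at_most {v. snd v \<in> {a..b} \<and> \<kappa> * (fst v - t * snd v) - c \<in> S}
           ((b - a) / \<kappa> * measure lebesgue S)" (is "area_at_most ?B _")
proof -
  have "closed S" using S by (rule compact_imp_closed)
  have "closed ((\<lambda>v. \<kappa> * (snd v - t * fst v) - c) -` S \<inter> fst -` {a..b})"
    using \<open>closed S\<close> by (intro closed_Int closed_vimage continuous_intros closed_atLeastAtMost)
  moreover have "closed ((\<lambda>v. \<kappa> * (fst v - t * snd v) - c) -` S \<inter> snd -` {a..b})"
    using \<open>closed S\<close> by (intro closed_Int closed_vimage continuous_intros closed_atLeastAtMost)
  moreover have "(\<lambda>v. \<kappa> * (snd v - t * fst v) - c) -` S \<inter> fst -` {a..b} = ?A"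
    "(\<lambda>v. \<kappa> * (fst v - t * snd v) - c) -` S \<inter> snd -` {a..b} = ?B" by auto
  ultimately have borel: "?A \<in> sets borel" "?B \<in> sets borel" by auto
  then have pair: "?A \<in> sets (lborel \<Otimes>\<^sub>M lborel)" "?B \<in> sets (lborel \<Otimes>\<^sub>M lborel)"
    unfolding lborel_prod by simp_all
  have "emeasure lebesgue ?A = emeasure (lborel \<Otimes>\<^sub>M lborel) ?A"
    unfolding lborel_prod using borel by simp
  also have "\<dots> = (\<integral>\<^sup>+x. emeasure lborel (Pair x -` ?A) \<partial>lborel)"
    using pair by (intro lborel.emeasure_pair_measure_alt)
  also have "\<dots> = ennreal ((b - a) / \<kappa> * measure lebesgue S)"
    using nn_integral_slices[OF assms] by (simp add: vimage_def)
  finally show "area_at_most ?A ((b - a) / \<kappa> * measure lebesgue S)"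
    unfolding area_at_most_def using borel by (intro bexI[of _ ?A]) auto
  have "emeasure lebesgue ?B = emeasure (lborel \<Otimes>\<^sub>M lborel) ?B"
    unfolding lborel_prod using borel by simp
  also have "\<dots> = (\<integral>\<^sup>+y. emeasure lborel ((\<lambda>x. (x, y)) -` ?B) \<partial>lborel)"
    using pair by (intro lborel_pair.emeasure_pair_measure_alt2)
  also have "\<dots> = ennreal ((b - a) / \<kappa> * measure lebesgue S)"
    using nn_integral_slices[OF assms] by (simp add: vimage_def)
  finally show "area_at_most ?B ((b - a) / \<kappa> * measure lebesgue S)"
    unfolding area_at_most_def using borel by (intro bexI[of _ ?B]) auto
qed

section \<open>Translates of a short arc\<close>

text \<open>
  The digits of a point of the Cantor set are split into the first and the last $m$. The first ones
  select a strip. The last ones, together with the errors, are located in the fattened projection of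
  $K_m$: the motion along the tangent $(\tau_1,\tau_2)$ cancels in $v_2-tv_1$, and what remains is at
  most $2$ from the position inside the smallest square and at most $2\Lambda$ from the curvature.
\<close>

lemma translate_in_strip:
  fixes v1 v2 q1 q2 P1 P2 \<tau>1 \<tau>2 s t \<Lambda> :: real
  assumes n: "2 * m \<le> n" "v1 + q1 \<in> cantor_stage n" "v2 + q2 \<in> cantor_stage n"
    and s: "0 \<le> s" "s * 4 ^ m \<le> 1" and "1 \<le> \<Lambda>"
    and q: "\<bar>q1 - P1 - s * \<tau>1\<bar> * (4 ^ m * 4 ^ m) \<le> \<Lambda>" "\<bar>q2 - P2 - s * \<tau>2\<bar> * (4 ^ m * 4 ^ m) \<le> \<Lambda>"
    and t: "\<bar>\<tau>1\<bar> \<le> 1" "\<tau>2 = t * \<tau>1" "\<bar>t\<bar> \<le> 1"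
  obtains x y where "x \<in> corners m" "y \<in> corners m"
    "v1 \<in> {x / 4 ^ m - P1 - 2 * \<Lambda> / 4 ^ m..x / 4 ^ m - P1 + 3 * \<Lambda> / 4 ^ m}"
    "(4 ^ m * 4 ^ m) * (v2 - t * v1) - (4 ^ m * (y - t * x) - (4 ^ m * 4 ^ m) * (P2 - t * P1))
       \<in> thick_projection t (4 * \<Lambda>) m"
proof -
  define Q :: real where "Q = 4 ^ m"
  have Q: "1 \<le> Q" by (simp add: Q_def)
  have Q2: "(4::real) ^ (2 * m) = Q * Q" by (simp add: Q_def mult_2 power_add)
  have digits: "\<exists>x\<in>corners m. \<exists>x'\<in>corners m. \<exists>\<theta>. 0 \<le> \<theta> \<and> \<theta> \<le> 1 \<and> Q * Q * z = Q * of_int x + of_int x' + \<theta>"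
    if stage: "z \<in> cantor_stage n" for z
  proof -
    obtain X where X: "X \<in> corners (2 * m)" "of_int X \<le> Q * Q * z" "Q * Q * z \<le> of_int X + 1"
      using cantor_stage_subset_corners[OF n(1) stage] unfolding Q2 by blast
    obtain x x' where x: "x \<in> corners m" "x' \<in> corners m" "X = 4 ^ m * x + x'"
      using X(1) unfolding mult_2 corners_add by auto
    have "real_of_int X = Q * of_int x + of_int x'" using x(3) by (simp add: Q_def)
    with X x(1,2) show ?thesis
      by (intro bexI[of _ x] bexI[of _ x'] exI[of _ "Q * Q * z - of_int X"]) auto
  qed
  obtain x x' \<theta>1 where x: "x \<in> corners m" "x' \<in> corners m" "0 \<le> \<theta>1" "\<theta>1 \<le> 1"
      "Q * Q * (v1 + q1) = Q * of_int x + of_int x' + \<theta>1"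
    using digits[OF n(2)] by blast
  obtain y y' \<theta>2 where y: "y \<in> corners m" "y' \<in> corners m" "0 \<le> \<theta>2" "\<theta>2 \<le> 1"
      "Q * Q * (v2 + q2) = Q * of_int y + of_int y' + \<theta>2"
    using digits[OF n(3)] by blast
  define \<rho>1 where "\<rho>1 = Q * Q * (q1 - P1 - s * \<tau>1)"
  define \<rho>2 where "\<rho>2 = Q * Q * (q2 - P2 - s * \<tau>2)"
  have \<rho>: "\<bar>\<rho>1\<bar> \<le> \<Lambda>" "\<bar>\<rho>2\<bar> \<le> \<Lambda>"
    using q Q by (simp_all add: \<rho>1_def \<rho>2_def abs_mult Q_def mult.commute)
  have v1: "Q * Q * v1 = Q * of_int x - Q * Q * P1 + (of_int x' + \<theta>1 - Q * Q * (s * \<tau>1) - \<rho>1)"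
    using x(5) by (simp add: \<rho>1_def algebra_simps)
  have v2: "Q * Q * v2 = Q * of_int y - Q * Q * P2 + (of_int y' + \<theta>2 - Q * Q * (s * \<tau>2) - \<rho>2)"
    using y(5) by (simp add: \<rho>2_def algebra_simps)
  show thesis
  proof (rule that[OF x(1) y(1)])
    have "0 \<le> of_int x' + \<theta>1" "of_int x' + \<theta>1 \<le> Q"
      using corners_bounds_real[OF x(2)] x(3,4) by (simp_all add: Q_def)
    moreover have "\<bar>Q * Q * (s * \<tau>1)\<bar> \<le> Q"
    proof -
      have "\<bar>s * \<tau>1\<bar> \<le> s" using s(1) t(1) by (simp add: abs_mult mult_left_le)
      then have "Q * Q * \<bar>s * \<tau>1\<bar> \<le> Q * Q * s" using Q by (intro mult_left_mono) auto
      also have "\<dots> = Q * (s * Q)" by (simp add: mult_ac)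
      also have "\<dots> \<le> Q * 1" using s(2) Q by (intro mult_left_mono) (auto simp: Q_def)
      finally show ?thesis using Q by (simp add: abs_mult)
    qed
    moreover have "Q \<le> \<Lambda> * Q" "\<Lambda> \<le> \<Lambda> * Q"
      using \<open>1 \<le> \<Lambda>\<close> Q by (simp_all add: mult_le_cancel_left1 mult_le_cancel_right1)
    ultimately have "Q * of_int x - Q * Q * P1 - 2 * \<Lambda> * Q \<le> Q * Q * v1"
        "Q * Q * v1 \<le> Q * of_int x - Q * Q * P1 + 3 * \<Lambda> * Q"
      unfolding v1 using \<rho>(1) by linarith+
    then have "Q * (of_int x - Q * P1 - 2 * \<Lambda>) \<le> Q * (Q * v1)"
        "Q * (Q * v1) \<le> Q * (of_int x - Q * P1 + 3 * \<Lambda>)"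
      by (simp_all add: algebra_simps)
    then have "of_int x - Q * P1 - 2 * \<Lambda> \<le> Q * v1" "Q * v1 \<le> of_int x - Q * P1 + 3 * \<Lambda>"
      using Q by simp_all
    then have "(of_int x - Q * P1 - 2 * \<Lambda>) / Q \<le> v1" "v1 \<le> (of_int x - Q * P1 + 3 * \<Lambda>) / Q"
      using Q by (simp_all add: pos_divide_le_eq pos_le_divide_eq mult.commute)
    then show "v1 \<in> {of_int x / 4 ^ m - P1 - 2 * \<Lambda> / 4 ^ m..of_int x / 4 ^ m - P1 + 3 * \<Lambda> / 4 ^ m}"
      using Q by (simp add: Q_def[symmetric] diff_divide_distrib add_divide_distrib)
    have "Q * Q * (v2 - t * v1) - (Q * (of_int y - t * of_int x) - Q * Q * (P2 - t * P1))
        = height t (x', y') + ((\<theta>2 - t * \<theta>1) - (\<rho>2 - t * \<rho>1))"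
    proof -
      have "Q * Q * (v2 - t * v1) = Q * Q * v2 - t * (Q * Q * v1)" by (simp add: algebra_simps)
      then show ?thesis unfolding v1 v2 height_def by (simp add: t(2) algebra_simps)
    qed
    moreover have "\<bar>(\<theta>2 - t * \<theta>1) - (\<rho>2 - t * \<rho>1)\<bar> \<le> 4 * \<Lambda>"
    proof -
      have "\<bar>t * \<theta>1\<bar> \<le> 1" using t(3) x(3,4) by (simp add: abs_mult mult_le_one)
      moreover have "\<bar>t * \<rho>1\<bar> \<le> \<Lambda>"
        using mult_mono[OF t(3) \<rho>(1)] by (simp add: abs_mult)
      ultimately show ?thesis using y(3,4) \<rho>(2) \<open>1 \<le> \<Lambda>\<close> by linarith
    qed
    moreover have "(x', y') \<in> corner_pairs m" using x y by (simp add: corner_pairs_def)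
    ultimately show "(4 ^ m * 4 ^ m) * (v2 - t * v1) -
        (4 ^ m * (of_int y - t * of_int x) - (4 ^ m * 4 ^ m) * (P2 - t * P1))
        \<in> thick_projection t (4 * \<Lambda>) m"
      unfolding thick_projection_def Q_def[symmetric] abs_le_iff
      by (intro UN_I[of "(x', y')"]) auto
  qed
qed

text \<open>
  Both cases for the direction reduce to the same strips because $K_n$ is symmetric in its two
  coordinates. There are $4^m$ strips, one for each square of generation $m$.
\<close>

lemma area_short_arc:
  fixes G :: "(real \<times> real) set" and P \<tau> :: "real \<times> real"
  assumes "2 * m \<le> n" "1 \<le> \<Lambda>" "norm \<tau> = 1" "\<bar>t\<bar> \<le> 1"
    and G: "\<And>q. q \<in> G \<Longrightarrow> \<exists>s. 0 \<le> s \<and> s * 4 ^ m \<le> 1 \<and>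
        norm (q - P - s *\<^sub>R \<tau>) * (4 ^ m * 4 ^ m) \<le> \<Lambda>"
    and t: "snd \<tau> = t * fst \<tau> \<or> fst \<tau> = t * snd \<tau>"
  shows "area_at_most {v. \<exists>q\<in>G. v + q \<in> four_corner_cantor n}
           (5 * \<Lambda> / 4 ^ m * density t (4 * \<Lambda>) m)"
proof -
  let ?Q = "4 ^ m * 4 ^ m :: real"
  let ?T = "thick_projection t (4 * \<Lambda>) m"
  let ?r = "5 * \<Lambda> / 4 ^ m / ?Q * measure lebesgue ?T"
  have \<tau>: "\<bar>fst \<tau>\<bar> \<le> 1" "\<bar>snd \<tau>\<bar> \<le> 1"
    using norm_fst_le[of "fst \<tau>" "snd \<tau>"] norm_snd_le[of "snd \<tau>" "fst \<tau>"] assms(3) by simp_all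
  have coords: "\<exists>s. 0 \<le> s \<and> s * 4 ^ m \<le> 1 \<and> \<bar>fst q - fst P - s * fst \<tau>\<bar> * ?Q \<le> \<Lambda> \<and>
      \<bar>snd q - snd P - s * snd \<tau>\<bar> * ?Q \<le> \<Lambda>" if "q \<in> G" for q
  proof -
    obtain s where s: "0 \<le> s" "s * 4 ^ m \<le> 1" "norm (q - P - s *\<^sub>R \<tau>) * ?Q \<le> \<Lambda>"
      using G[OF \<open>q \<in> G\<close>] by blast
    define z where "z = q - P - s *\<^sub>R \<tau>"
    have "\<bar>fst z\<bar> \<le> norm z" "\<bar>snd z\<bar> \<le> norm z"
      using norm_fst_le[of "fst z" "snd z"] norm_snd_le[of "snd z" "fst z"] by simp_all
    then have "\<bar>fst z\<bar> * ?Q \<le> norm z * ?Q" "\<bar>snd z\<bar> * ?Q \<le> norm z * ?Q"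
      by (simp_all add: mult_right_mono)
    then have "\<bar>fst z\<bar> * ?Q \<le> \<Lambda>" "\<bar>snd z\<bar> * ?Q \<le> \<Lambda>"
      using s(3) unfolding z_def by linarith+
    then show ?thesis using s(1,2) by (intro exI[of _ s]) (simp add: z_def)
  qed
  define R1 where "R1 u = {v :: real \<times> real.
      fst v \<in> {of_int (fst u) / 4 ^ m - fst P - 2 * \<Lambda> / 4 ^ m..of_int (fst u) / 4 ^ m - fst P + 3 * \<Lambda> / 4 ^ m} \<and>
      ?Q * (snd v - t * fst v) - (4 ^ m * (of_int (snd u) - t * of_int (fst u)) - ?Q * (snd P - t * fst P)) \<in> ?T}"
    for u :: "int \<times> int"
  define R2 where "R2 u = {v :: real \<times> real.
      snd v \<in> {of_int (fst u) / 4 ^ m - snd P - 2 * \<Lambda> / 4 ^ m..of_int (fst u) / 4 ^ m - snd P + 3 * \<Lambda> / 4 ^ m} \<and>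
      ?Q * (fst v - t * snd v) - (4 ^ m * (of_int (snd u) - t * of_int (fst u)) - ?Q * (fst P - t * snd P)) \<in> ?T}"
    for u :: "int \<times> int"
  have len: "x / 4 ^ m - y + 3 * \<Lambda> / 4 ^ m - (x / 4 ^ m - y - 2 * \<Lambda> / 4 ^ m) = 5 * \<Lambda> / 4 ^ m" for x y :: real
    by (simp add: field_simps)
  have le: "x / 4 ^ m - y - 2 * \<Lambda> / 4 ^ m \<le> x / 4 ^ m - y + 3 * \<Lambda> / 4 ^ m" for x y :: real
  proof -
    have "0 \<le> 5 * \<Lambda> / 4 ^ m" using assms(2) by simp
    with len[of x y] show ?thesis by linarith
  qed
  have area1: "area_at_most (R1 u) ?r" for u
    unfolding R1_def len[symmetric, of "of_int (fst u)" "fst P"]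
    by (rule area_strip(1)[OF compact_thick_projection le]) simp
  have area2: "area_at_most (R2 u) ?r" for u
    unfolding R2_def len[symmetric, of "of_int (fst u)" "snd P"]
    by (rule area_strip(2)[OF compact_thick_projection le]) simp
  have sum: "(\<Sum>u\<in>corner_pairs m. ?r) = 5 * \<Lambda> / 4 ^ m * density t (4 * \<Lambda>) m"
    by (simp add: card_corner_pairs density_def)
  have "0 \<le> ?r" using assms(2) by simp
  from t show ?thesis
  proof
    assume t: "snd \<tau> = t * fst \<tau>"
    have "{v. \<exists>q\<in>G. v + q \<in> four_corner_cantor n} \<subseteq> (\<Union>u\<in>corner_pairs m. R1 u)"
    proof clarify
      fix v1 v2 q1 q2 assume q: "(q1, q2) \<in> G" "(v1, v2) + (q1, q2) \<in> four_corner_cantor n"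
      then have stage: "v1 + q1 \<in> cantor_stage n" "v2 + q2 \<in> cantor_stage n"
        by (simp_all add: four_corner_cantor_def)
      obtain s where s: "0 \<le> s" "s * 4 ^ m \<le> 1" "\<bar>q1 - fst P - s * fst \<tau>\<bar> * ?Q \<le> \<Lambda>"
          "\<bar>q2 - snd P - s * snd \<tau>\<bar> * ?Q \<le> \<Lambda>"
        using coords[OF q(1)] by auto
      obtain x y where xy: "x \<in> corners m" "y \<in> corners m" "(v1, v2) \<in> R1 (x, y)"
        using translate_in_strip[OF assms(1) stage s(1,2) assms(2) s(3,4) \<tau>(1) t assms(4), of thesis]
        unfolding R1_def by simp
      then show "(v1, v2) \<in> (\<Union>u\<in>corner_pairs m. R1 u)"
        by (intro UN_I[of "(x, y)"]) (auto simp: corner_pairs_def)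
    qed
    moreover have "area_at_most (\<Union>u\<in>corner_pairs m. R1 u) (\<Sum>u\<in>corner_pairs m. ?r)"
      using area1 \<open>0 \<le> ?r\<close> by (intro area_at_most_UN) auto
    ultimately show ?thesis unfolding sum using area_at_most_subset by blast
  next
    assume t: "fst \<tau> = t * snd \<tau>"
    have "{v. \<exists>q\<in>G. v + q \<in> four_corner_cantor n} \<subseteq> (\<Union>u\<in>corner_pairs m. R2 u)"
    proof clarify
      fix v1 v2 q1 q2 assume q: "(q1, q2) \<in> G" "(v1, v2) + (q1, q2) \<in> four_corner_cantor n"
      then have stage: "v2 + q2 \<in> cantor_stage n" "v1 + q1 \<in> cantor_stage n"
        by (simp_all add: four_corner_cantor_def)
      obtain s where s: "0 \<le> s" "s * 4 ^ m \<le> 1" "\<bar>q2 - snd P - s * snd \<tau>\<bar> * ?Q \<le> \<Lambda>"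
          "\<bar>q1 - fst P - s * fst \<tau>\<bar> * ?Q \<le> \<Lambda>"
        using coords[OF q(1)] by auto
      obtain x y where xy: "x \<in> corners m" "y \<in> corners m" "(v1, v2) \<in> R2 (x, y)"
        using translate_in_strip[OF assms(1) stage s(1,2) assms(2) s(3,4) \<tau>(2) t assms(4), of thesis]
        unfolding R2_def by simp
      then show "(v1, v2) \<in> (\<Union>u\<in>corner_pairs m. R2 u)"
        by (intro UN_I[of "(x, y)"]) (auto simp: corner_pairs_def)
    qed
    moreover have "area_at_most (\<Union>u\<in>corner_pairs m. R2 u) (\<Sum>u\<in>corner_pairs m. ?r)"
      using area2 \<open>0 \<le> ?r\<close> by (intro area_at_most_UN) auto
    ultimately show ?thesis unfolding sum using area_at_most_subset by blast
  qed
qed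

section \<open>A bound for a single arc\<close>

text \<open>
  The slope of a direction with respect to its dominant coordinate axis, so that it lies in
  $[-1,1]$.
\<close>

definition slope :: "real \<times> real \<Rightarrow> real" where
  "slope u = (if \<bar>snd u\<bar> \<le> \<bar>fst u\<bar> then snd u / fst u else fst u / snd u)"

text \<open>
  The dominant coordinate and its sign. Within one of these four classes of directions the slope
  determines the unit vector.
\<close>

definition sector :: "real \<times> real \<Rightarrow> bool \<times> bool" where
  "sector u = (\<bar>snd u\<bar> \<le> \<bar>fst u\<bar>, if \<bar>snd u\<bar> \<le> \<bar>fst u\<bar> then 0 < fst u else 0 < snd u)"

lemma abs_slope_le_one: "\<bar>slope u\<bar> \<le> 1"
  by (cases "fst u = 0") (auto simp: slope_def abs_divide divide_le_eq)

lemma slope_spans: "snd u = slope u * fst u \<or> fst u = slope u * snd u"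
  by (cases "fst u = 0") (auto simp: slope_def)

text \<open>
  With $x$ the scalar product of the two unit vectors, the cross product has the square $1-x^2$, and
  $1-x^2\ge 1-x$ since the angle between the vectors is not obtuse. The difference of the quotients is the cross
  product divided by $ac\le 1$, and the distance of the vectors has the square $2(1-x)$.
\<close>

lemma quotient_separation:
  fixes a b c d :: real
  assumes unit: "a\<^sup>2 + b\<^sup>2 = 1" "c\<^sup>2 + d\<^sup>2 = 1" and "\<bar>b\<bar> \<le> \<bar>a\<bar>" "\<bar>d\<bar> \<le> \<bar>c\<bar>" "0 < a * c"
  shows "sqrt ((a - c)\<^sup>2 + (b - d)\<^sup>2) \<le> 2 * \<bar>b / a - d / c\<bar>"
proof (rule real_le_lsqrt)
  have nz: "a \<noteq> 0" "c \<noteq> 0" using assms(5) by auto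
  define x where "x = a * c + b * d"
  have "\<bar>b * d\<bar> \<le> \<bar>a * c\<bar>"
    unfolding abs_mult using assms(3,4) by (intro mult_mono) auto
  then have x: "0 \<le> x" unfolding x_def using assms(5) by linarith
  have lagrange: "(b * c - a * d)\<^sup>2 = 1 - x\<^sup>2"
  proof -
    have "(b * c - a * d)\<^sup>2 + x\<^sup>2 = (a\<^sup>2 + b\<^sup>2) * (c\<^sup>2 + d\<^sup>2)"
      unfolding x_def by (simp add: power2_eq_square algebra_simps)
    then show ?thesis using unit by simp
  qed
  have "0 \<le> 1 - x\<^sup>2" using lagrange by (metis zero_le_power2)
  then have "x \<le> 1" by (simp add: power2_le_iff_abs_le abs_le_square_iff[of x 1, simplified, symmetric])
  then have "1 - x \<le> (1 - x) * (1 + x)" using x by (simp add: mult_le_cancel_left1)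
  also have "\<dots> = (b * c - a * d)\<^sup>2" unfolding lagrange by (simp add: power2_eq_square algebra_simps)
  also have "\<dots> \<le> (b / a - d / c)\<^sup>2"
  proof -
    have "a\<^sup>2 \<le> 1" "c\<^sup>2 \<le> 1" using unit zero_le_power2[of b] zero_le_power2[of d] by linarith+
    then have "a\<^sup>2 * c\<^sup>2 \<le> 1" by (simp add: mult_le_one)
    then have "(b / a - d / c)\<^sup>2 * (a\<^sup>2 * c\<^sup>2) \<le> (b / a - d / c)\<^sup>2" by (intro mult_left_le) auto
    moreover have "(b / a - d / c)\<^sup>2 * (a\<^sup>2 * c\<^sup>2) = ((b / a - d / c) * (a * c))\<^sup>2"
      by (simp add: power_mult_distrib)
    moreover have "(b / a - d / c) * (a * c) = b * c - a * d" using nz by (simp add: field_simps)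
    ultimately show ?thesis by simp
  qed
  finally have *: "1 - x \<le> (b / a - d / c)\<^sup>2" .
  have "(a - c)\<^sup>2 + (b - d)\<^sup>2 = (a\<^sup>2 + b\<^sup>2) + (c\<^sup>2 + d\<^sup>2) - 2 * x"
    unfolding x_def by (simp add: power2_eq_square algebra_simps)
  then have "(a - c)\<^sup>2 + (b - d)\<^sup>2 = 2 * (1 - x)" using unit by simp
  also have "\<dots> \<le> 4 * (b / a - d / c)\<^sup>2" using * x by (smt (verit) zero_le_power2)
  also have "\<dots> = (2 * \<bar>b / a - d / c\<bar>)\<^sup>2" by (simp add: power_mult_distrib)
  finally show "(a - c)\<^sup>2 + (b - d)\<^sup>2 \<le> (2 * \<bar>b / a - d / c\<bar>)\<^sup>2" .
qed simp

lemma slope_separation: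
  assumes "norm u = 1" "norm v = 1" "sector u = sector v"
  shows "norm (u - v) \<le> 2 * \<bar>slope u - slope v\<bar>"
proof -
  obtain a b c d where uv: "u = (a, b)" "v = (c, d)" by (cases u, cases v)
  have unit: "a\<^sup>2 + b\<^sup>2 = 1" "c\<^sup>2 + d\<^sup>2 = 1"
    using assms(1,2) by (simp_all add: uv norm_Pair real_sqrt_eq_1_iff)
  have norm: "norm (u - v) = sqrt ((a - c)\<^sup>2 + (b - d)\<^sup>2)" by (simp add: uv norm_Pair)
  show ?thesis
  proof (cases "\<bar>b\<bar> \<le> \<bar>a\<bar>")
    case True
    with assms(3) have dc: "\<bar>d\<bar> \<le> \<bar>c\<bar>" "0 < a \<longleftrightarrow> 0 < c" by (auto simp: uv sector_def split: if_splits)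
    have "a \<noteq> 0" "c \<noteq> 0" using unit True dc(1) by auto
    then have "0 < a * c" using dc(2) by (auto simp: zero_less_mult_iff)
    then show ?thesis unfolding norm
      using quotient_separation[OF unit True dc(1)] True dc(1) by (simp add: slope_def uv)
  next
    case False
    with assms(3) have dc: "\<not> \<bar>d\<bar> \<le> \<bar>c\<bar>" "0 < b \<longleftrightarrow> 0 < d" by (auto simp: uv sector_def split: if_splits)
    have "b \<noteq> 0" "d \<noteq> 0" using False dc(1) by auto
    then have "0 < b * d" using dc(2) by (auto simp: zero_less_mult_iff)
    then show ?thesis unfolding norm
      using quotient_separation[of b a d c] unit False dc(1) by (simp add: slope_def uv add.commute)
  qed
qed

text \<open>
  The number of pieces is $O(4^m)$ and each contributes $4^{-m}$ times a density. Pieces with a good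
  slope have density $O(1/p)$, and the proportion of the others is $O(1/p)$ by the separation of the
  slopes, which is where the lower Lipschitz bound for the tangent enters.
\<close>

lemma arc_area:
  assumes "bilipschitz_tangent_arc a b g"
  obtains c where "0 \<le> c"
    "\<And>p m n. 1 \<le> p \<Longrightarrow> saturation_level p \<le> m \<Longrightarrow> 2 * m \<le> n \<Longrightarrow>
       area_at_most {v. \<exists>q\<in>g ` {a..b}. v + q \<in> four_corner_cantor n} (c / real p)"
proof -
  obtain g' \<Lambda> where "a < b" and deriv: "\<And>t. t \<in> {a..b} \<Longrightarrow> (g has_vector_derivative g' t) (at t within {a..b})"
    and unit: "\<And>t. t \<in> {a..b} \<Longrightarrow> norm (g' t) = 1" and "1 \<le> \<Lambda>"
    and lower: "\<And>s t. s \<in> {a..b} \<Longrightarrow> t \<in> {a..b} \<Longrightarrow> \<bar>s - t\<bar> / \<Lambda> \<le> norm (g' s - g' t)"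
    and upper: "\<And>s t. s \<in> {a..b} \<Longrightarrow> t \<in> {a..b} \<Longrightarrow> norm (g' s - g' t) \<le> \<Lambda> * \<bar>s - t\<bar>"
    using assms unfolding bilipschitz_tangent_arc_def by metis
  define c where "c = 5 * \<Lambda> * ((b - a + 1) * (6 + 16 * \<Lambda>) + 1024 * \<Lambda>\<^sup>2)"
  show thesis
  proof (rule that[of c])
    show "0 \<le> c" unfolding c_def using \<open>a < b\<close> \<open>1 \<le> \<Lambda>\<close> by simp
  next
    fix p m n :: nat
    assume p: "1 \<le> p" and m: "saturation_level p \<le> m" and n: "2 * m \<le> n"
    define Q :: real where "Q = 4 ^ m"
    have Q: "1 \<le> Q" by (simp add: Q_def)
    define node where "node j = a + real j / Q" for j
    define I where "I = {j. node j \<le> b}"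
    define u where "u j = g' (node j)" for j
    define D where "D j = density (slope (u j)) (4 * \<Lambda>) m" for j
    have node: "node j \<in> {a..b}" if "j \<in> I" for j
      using that Q by (simp add: I_def node_def)
    have I_sub: "I \<subseteq> {..nat \<lfloor>(b - a) * Q\<rfloor>}"
    proof
      fix j assume "j \<in> I"
      then have "real j \<le> (b - a) * Q" using Q by (simp add: I_def node_def field_simps)
      then show "j \<in> {..nat \<lfloor>(b - a) * Q\<rfloor>}" by (simp add: le_nat_floor)
    qed
    then have finI: "finite I" by (rule finite_subset) simp
    have cardI: "real (card I) \<le> (b - a + 1) * Q"
    proof -
      have "card I \<le> Suc (nat \<lfloor>(b - a) * Q\<rfloor>)" using card_mono[OF _ I_sub] by simp
      then have "real (card I) \<le> 1 + real (nat \<lfloor>(b - a) * Q\<rfloor>)" by linarith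
      also have "real (nat \<lfloor>(b - a) * Q\<rfloor>) \<le> (b - a) * Q"
        using \<open>a < b\<close> Q by (intro of_nat_floor) auto
      finally show ?thesis using Q by (simp add: algebra_simps)
    qed
    define G where "G j = g ` {s \<in> {a..b}. node j \<le> s \<and> s \<le> node j + 1 / Q}" for j
    have piece: "area_at_most {v. \<exists>q\<in>G j. v + q \<in> four_corner_cantor n} (5 * \<Lambda> / Q * D j)"
      if j: "j \<in> I" for j
      unfolding Q_def D_def
    proof (rule area_short_arc[where P = "g (node j)" and \<tau> = "u j"])
      show "norm (u j) = 1" unfolding u_def using unit[OF node[OF j]] .
      show "snd (u j) = slope (u j) * fst (u j) \<or> fst (u j) = slope (u j) * snd (u j)"
        by (rule slope_spans)
      fix q assume "q \<in> G j"
      then obtain s where s: "s \<in> {a..b}" "node j \<le> s" "s \<le> node j + 1 / Q" "q = g s"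
        unfolding G_def by auto
      define h where "h = s - node j"
      have h: "0 \<le> h" "h * Q \<le> 1" using s Q by (simp_all add: h_def field_simps)
      \<comment> \<open>The tangent varies by at most $\Lambda h$ along the piece, so the piece leaves its tangent line by at most $\Lambda h^2$.\<close>
      have "norm (g s - g (node j) - (s - node j) *\<^sub>R g' (node j)) \<le> norm (s - node j) * (\<Lambda> * h)"
      proof (rule vector_differentiable_bound_linearization)
        show "closed_segment (node j) s \<subseteq> {node j..s}" using s(2) by (simp add: closed_segment_eq_real_ivl)
        fix x assume x: "x \<in> {node j..s}"
        then have x': "x \<in> {a..b}" using node[OF j] s(1) by auto
        show "(g has_vector_derivative g' x) (at x within {node j..s})"
          by (rule has_vector_derivative_within_subset[OF deriv[OF x']]) (use node[OF j] s(1) in auto)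
        have "norm (g' x - g' (node j)) \<le> \<Lambda> * \<bar>x - node j\<bar>" by (rule upper[OF x' node[OF j]])
        also have "\<dots> \<le> \<Lambda> * h" using x \<open>1 \<le> \<Lambda>\<close> by (intro mult_left_mono) (auto simp: h_def)
        finally show "norm (g' x - g' (node j)) \<le> \<Lambda> * h" .
      qed (use s(2) in auto)
      then have "norm (q - g (node j) - h *\<^sub>R u j) \<le> h * (\<Lambda> * h)"
        using h(1) by (simp add: s(4) h_def u_def)
      then have "norm (q - g (node j) - h *\<^sub>R u j) * (Q * Q) \<le> h * (\<Lambda> * h) * (Q * Q)"
        using Q by (intro mult_right_mono) auto
      also have "\<dots> = \<Lambda> * ((h * Q) * (h * Q))" by (simp add: mult_ac)
      also have "\<dots> \<le> \<Lambda> * 1"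
      proof (rule mult_left_mono)
        have "0 \<le> h * Q" using h(1) Q by simp
        then show "(h * Q) * (h * Q) \<le> 1" by (rule mult_le_one[OF h(2) _ h(2)])
      qed (use \<open>1 \<le> \<Lambda>\<close> in simp)
      finally show "\<exists>s. 0 \<le> s \<and> s * 4 ^ m \<le> 1 \<and>
          norm (q - g (node j) - s *\<^sub>R u j) * (4 ^ m * 4 ^ m) \<le> \<Lambda>"
        using h unfolding Q_def by (intro exI[of _ h]) simp
    qed (use n \<open>1 \<le> \<Lambda>\<close> abs_slope_le_one in auto)
    have cover: "{v. \<exists>q\<in>g ` {a..b}. v + q \<in> four_corner_cantor n}
        \<subseteq> (\<Union>j\<in>I. {v. \<exists>q\<in>G j. v + q \<in> four_corner_cantor n})"
    proof
      fix v assume "v \<in> {v. \<exists>q\<in>g ` {a..b}. v + q \<in> four_corner_cantor n}"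
      then obtain s where s: "s \<in> {a..b}" and v: "v + g s \<in> four_corner_cantor n" by blast
      define j where "j = nat \<lfloor>(s - a) * Q\<rfloor>"
      have "0 \<le> (s - a) * Q" using s Q by simp
      then have "real j \<le> (s - a) * Q" "(s - a) * Q \<le> real j + 1"
        unfolding j_def by linarith+
      then have j: "node j \<le> s" "s \<le> node j + 1 / Q" using Q by (simp_all add: node_def field_simps)
      then have "j \<in> I" "g s \<in> G j" using s by (auto simp: I_def G_def)
      with v show "v \<in> (\<Union>j\<in>I. {v. \<exists>q\<in>G j. v + q \<in> four_corner_cantor n})" by blast
    qed
    have D0: "0 \<le> D j" for j by (simp add: D_def density_nonneg)
    have "area_at_most (\<Union>j\<in>I. {v. \<exists>q\<in>G j. v + q \<in> four_corner_cantor n}) (\<Sum>j\<in>I. 5 * \<Lambda> / Q * D j)"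
      using finI piece \<open>1 \<le> \<Lambda>\<close> Q D0 by (intro area_at_most_UN) auto
    moreover have "(\<Sum>j\<in>I. 5 * \<Lambda> / Q * D j) \<le> c / real p"
    proof -
      define B where "B = {j\<in>I. \<not> good_slope p (slope (u j))}"
      have finB: "finite B" using finI by (simp add: B_def)
      have good: "D j \<le> (6 + 16 * \<Lambda>) / p" if "j \<in> I - B" for j
        using density_good_slope[of p "slope (u j)" "4 * \<Lambda>" m] that p m \<open>1 \<le> \<Lambda>\<close>
        by (simp add: B_def D_def abs_slope_le_one)
      have bad: "D j \<le> 8 * \<Lambda>" for j
        using density_antimono[of 0 m "slope (u j)" "4 * \<Lambda>"] \<open>1 \<le> \<Lambda>\<close> by (simp add: D_def density_0)
      have cardB: "real (card B) \<le> 128 * \<Lambda> * Q / p"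
      proof -
        have class_card: "real (card {j\<in>B. sector (u j) = k}) \<le> 16 * (2 * \<Lambda>) * 4 ^ m / p" for k
        proof (rule card_bad_slopes[where \<tau> = "\<lambda>j. slope (u j)"])
          have "depth p p \<le> saturation_level p" using p by (simp add: saturation_level_def)
          then show "depth p p \<le> m" using m by linarith
          fix i j assume ij: "i \<in> {j\<in>B. sector (u j) = k}" "j \<in> {j\<in>B. sector (u j) = k}" "i \<le> j"
          then have I: "i \<in> I" "j \<in> I" by (auto simp: B_def)
          have "\<bar>node i - node j\<bar> / \<Lambda> \<le> norm (u i - u j)"
            unfolding u_def by (rule lower[OF node[OF I(1)] node[OF I(2)]])
          also have "\<dots> \<le> 2 * \<bar>slope (u i) - slope (u j)\<bar>"
            using ij unit[OF node[OF I(1)]] unit[OF node[OF I(2)]]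
            by (intro slope_separation) (auto simp: u_def)
          also have "\<bar>node i - node j\<bar> = (real j - real i) / Q"
            using ij(3) Q by (simp add: node_def diff_divide_distrib[symmetric] abs_divide)
          finally show "1 / (2 * \<Lambda> * 4 ^ m) * (real j - real i) \<le> \<bar>slope (u i) - slope (u j)\<bar>"
            unfolding Q_def using \<open>1 \<le> \<Lambda>\<close> by (simp add: field_simps)
        qed (use finI p \<open>1 \<le> \<Lambda>\<close> abs_slope_le_one in \<open>auto simp: B_def\<close>)
        have "B = (\<Union>k\<in>UNIV. {j\<in>B. sector (u j) = k})" by auto
        then have "card B \<le> (\<Sum>k\<in>UNIV. card {j\<in>B. sector (u j) = k})"
          using card_UN_le[of "UNIV :: (bool \<times> bool) set" "\<lambda>k. {j\<in>B. sector (u j) = k}"] by simp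
        then have "real (card B) \<le> real (\<Sum>k\<in>UNIV. card {j\<in>B. sector (u j) = k})"
          unfolding of_nat_le_iff .
        also have "\<dots> \<le> (\<Sum>k\<in>(UNIV :: (bool \<times> bool) set). 16 * (2 * \<Lambda>) * 4 ^ m / p)"
          unfolding of_nat_sum using class_card by (intro sum_mono)
        also have "\<dots> = 128 * \<Lambda> * Q / p" by (simp add: Q_def card_UNIV_bool flip: UNIV_Times_UNIV)
        finally show ?thesis .
      qed
      have "(\<Sum>j\<in>I. D j) = (\<Sum>j\<in>I - B. D j) + (\<Sum>j\<in>B. D j)"
        using finI by (intro sum.subset_diff) (auto simp: B_def)
      also have "\<dots> \<le> (\<Sum>j\<in>I - B. (6 + 16 * \<Lambda>) / p) + (\<Sum>j\<in>B. 8 * \<Lambda>)"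
        using good bad by (intro add_mono sum_mono) auto
      also have "\<dots> = card (I - B) * ((6 + 16 * \<Lambda>) / p) + card B * (8 * \<Lambda>)" by simp
      also have "\<dots> \<le> ((b - a + 1) * Q) * ((6 + 16 * \<Lambda>) / p) + (128 * \<Lambda> * Q / p) * (8 * \<Lambda>)"
      proof (intro add_mono mult_right_mono)
        have "card (I - B) \<le> card I" using finI by (intro card_mono) auto
        with cardI show "real (card (I - B)) \<le> (b - a + 1) * Q" by linarith
      qed (use cardB \<open>1 \<le> \<Lambda>\<close> in auto)
      also have "\<dots> = Q / p * ((b - a + 1) * (6 + 16 * \<Lambda>) + 1024 * \<Lambda>\<^sup>2)"
        by (simp add: divide_inverse algebra_simps power2_eq_square)
      finally have "(\<Sum>j\<in>I. D j) \<le> Q / p * ((b - a + 1) * (6 + 16 * \<Lambda>) + 1024 * \<Lambda>\<^sup>2)" .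
      then have "5 * \<Lambda> / Q * (\<Sum>j\<in>I. D j)
          \<le> 5 * \<Lambda> / Q * (Q / p * ((b - a + 1) * (6 + 16 * \<Lambda>) + 1024 * \<Lambda>\<^sup>2))"
        using Q \<open>1 \<le> \<Lambda>\<close> by (intro mult_left_mono) auto
      also have "\<dots> = c / p" using Q by (simp add: c_def)
      finally show ?thesis by (simp add: sum_distrib_left)
    qed
    ultimately show "area_at_most {v. \<exists>q\<in>g ` {a..b}. v + q \<in> four_corner_cantor n} (c / real p)"
      using cover area_at_most_subset area_at_most_mono by meson
  qed
qed

section \<open>The inverse tower function\<close>

text \<open>
  The thresholds of the inverse tower function.
\<close>

primrec tower :: "nat \<Rightarrow> real" where
  "tower 0 = 1"
| "tower (Suc m) = exp (tower m)"

lemma le_tower: "real m \<le> tower m"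
proof (induction m)
  case (Suc m)
  then show ?case using exp_ge_add_one_self[of "tower m"] by (simp, linarith)
qed simp

lemma tower_ge_one: "1 \<le> tower m"
  by (induction m) (auto intro: order_trans)

lemma iterated_ln_le_one: "x \<le> tower m \<Longrightarrow> \<exists>j\<le>m. (ln ^^ j) x \<le> 1"
proof (induction m arbitrary: x)
  case (Suc m)
  show ?case
  proof (cases "x \<le> 1")
    case False
    then have "ln x \<le> ln (tower (Suc m))" using Suc.prems by (subst ln_le_cancel_iff) auto
    then have "ln x \<le> tower m" by simp
    then obtain j where "j \<le> m" "(ln ^^ j) (ln x) \<le> 1" using Suc.IH by blast
    then show ?thesis by (intro exI[of _ "Suc j"]) (simp add: funpow_Suc_right del: funpow.simps)
  qed (auto intro: exI[of _ 0])
qed (auto intro: exI[of _ 0])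

lemma log_star_le: "x \<le> tower m \<Longrightarrow> log_star x \<le> m"
  unfolding log_star_def using iterated_ln_le_one[of x m] Least_le order_trans by metis

lemma iterated_ln_gt_tower: "tower m < x \<Longrightarrow> j \<le> m \<Longrightarrow> tower (m - j) < (ln ^^ j) x"
proof (induction j)
  case (Suc j)
  have "m - j = Suc (m - Suc j)" using Suc.prems(2) by simp
  then have "exp (tower (m - Suc j)) < (ln ^^ j) x" using Suc by simp
  then have "tower (m - Suc j) < ln ((ln ^^ j) x)"
    by (metis exp_gt_zero ln_exp ln_less_cancel_iff order_less_trans)
  then show ?case by simp
qed simp

lemma log_star_gt:
  assumes "tower m < x"
  shows "m < log_star x"
proof (rule ccontr)
  assume "\<not> m < log_star x"
  then have "1 < (ln ^^ log_star x) x"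
    using iterated_ln_gt_tower[OF assms, of "log_star x"] tower_ge_one order_le_less_trans by (metis not_less)
  moreover obtain M where "x \<le> real M" using real_arch_simple by blast
  then have "x \<le> tower M" using le_tower order_trans by blast
  then obtain j where "(ln ^^ j) x \<le> 1" using iterated_ln_le_one by blast
  then have "(ln ^^ log_star x) x \<le> 1" unfolding log_star_def by (rule LeastI)
  ultimately show False by simp
qed

text \<open>
  Everything is bounded by powers of two: the left-hand side is at most $2^{4k+5}\le e^{4k+5}$, and
  $4k+5\le 2^k\le e^k$ for $k\ge 5$.
\<close>

lemma next_depth_le_exp_exp:
  assumes "p \<le> k" "5 \<le> k"
  shows "real (gap p k + k) \<le> exp (exp (real k))"
proof -
  have two: "4 * k + 5 \<le> 2 ^ k" using assms(2)
  proof (induction k rule: dec_induct)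
    case (step n)
    then show ?case by simp
  qed simp
  then have k: "k + 2 \<le> 2 ^ k" "p \<le> 2 ^ k" using assms by linarith+
  have "p * 4 ^ (k + 2) * (k + 2) \<le> 2 ^ k * 4 ^ (k + 2) * 2 ^ k"
    using k by (intro mult_mono) auto
  also have "\<dots> = 16 * 2 ^ (4 * k)"
  proof -
    have "(4::nat) ^ k = 2 ^ k * 2 ^ k" by (simp add: power_mult_distrib[symmetric])
    moreover have "(2::nat) ^ (4 * k) = 2 ^ k * 2 ^ k * (2 ^ k * 2 ^ k)"
      by (simp add: power_add[symmetric])
    ultimately show ?thesis by (simp add: power_add)
  qed
  finally have "gap p k + k \<le> 16 * 2 ^ (4 * k) + 2 ^ k" using k by (simp add: gap_def)
  also have "(2::nat) ^ k \<le> 2 ^ (4 * k)" by (intro power_increasing) auto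
  also have "16 * 2 ^ (4 * k) + 2 ^ (4 * k) \<le> (2::nat) ^ (4 * k + 5)" by (simp add: power_add)
  finally have "real (gap p k + k) \<le> real (2 ^ (4 * k + 5))" by (simp only: of_nat_le_iff)
  also have "\<dots> = 2 ^ (4 * k + 5)" by simp
  also have "\<dots> \<le> exp 1 ^ (4 * k + 5)"
    using exp_ge_add_one_self[of 1] by (intro power_mono) auto
  also have "\<dots> = exp (real (4 * k + 5))" by (simp flip: exp_of_nat_mult)
  also have "\<dots> \<le> exp (exp (real k))"
  proof -
    have "real (4 * k + 5) \<le> real (2 ^ k)" using two by (simp only: of_nat_le_iff)
    also have "\<dots> = 2 ^ k" by simp
    also have "\<dots> \<le> exp 1 ^ k" using exp_ge_add_one_self[of 1] by (intro power_mono) auto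
    also have "\<dots> = exp (real k)" by (simp flip: exp_of_nat_mult)
    finally show ?thesis by simp
  qed
  finally show ?thesis .
qed

lemma depth_le_tower:
  assumes "5 \<le> p"
  shows "real (depth p i) \<le> tower (p + 2 * i)"
proof (induction i)
  case (Suc i)
  have "p \<le> depth p i" using depth_mono[of 0 i p] by simp
  then have "real (depth p (Suc i)) \<le> exp (exp (real (depth p i)))"
    using next_depth_le_exp_exp[of p "depth p i"] assms by simp
  also have "\<dots> \<le> exp (exp (tower (p + 2 * i)))" using Suc by simp
  finally show ?case by simp
qed (use le_tower in simp)

lemma saturation_level_le_tower:
  assumes "5 \<le> p"
  shows "real (2 * saturation_level p) \<le> tower (3 * p + 2)"
proof -
  let ?k = "depth p p"
  have k: "p \<le> ?k" using depth_mono[of 0 p p] by simp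
  have "2 * (4 ^ ?k * ?k) \<le> 16 * 4 ^ ?k * (?k + 2)" by (simp add: algebra_simps)
  then have "p * (2 * (4 ^ ?k * ?k)) \<le> p * (16 * 4 ^ ?k * (?k + 2))" by (rule mult_le_mono2)
  then have "2 * saturation_level p \<le> gap p ?k + ?k"
    by (simp add: saturation_level_def gap_def power_add algebra_simps)
  then have "real (2 * saturation_level p) \<le> real (gap p ?k + ?k)" by (simp only: of_nat_le_iff)
  also have "\<dots> \<le> exp (exp (real ?k))" using k assms by (intro next_depth_le_exp_exp) auto
  also have "\<dots> \<le> exp (exp (tower (p + 2 * p)))" using depth_le_tower[OF assms, of p] by simp
  also have "\<dots> = tower (3 * p + 2)" by (simp add: numeral_eq_Suc)
  finally show ?thesis .
qed

section \<open>The Favard curve length\<close>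

lemma interval_subset_pieces:
  fixes p :: "nat \<Rightarrow> real"
  shows "{p 0..p N} \<subseteq> {p 0} \<union> (\<Union>i<N. {p i..p (Suc i)})"
proof (induction N)
  case (Suc N)
  show ?case
  proof
    fix s assume s: "s \<in> {p 0..p (Suc N)}"
    show "s \<in> {p 0} \<union> (\<Union>i<Suc N. {p i..p (Suc i)})"
    proof (cases "s \<le> p N")
      case True
      then have "s \<in> {p 0..p N}" using s by simp
      from subsetD[OF Suc.IH this] show ?thesis unfolding lessThan_Suc by blast
    next
      case False
      then have "s \<in> {p N..p (Suc N)}" using s by simp
      then show ?thesis unfolding lessThan_Suc by blast
    qed
  qed
qed auto

lemma favard_curve_length_le_inverse:
  assumes "piecewise_bilipschitz_tangent_curve C"
  obtains c where "0 \<le> c"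
    "\<And>p n. 1 \<le> p \<Longrightarrow> 2 * saturation_level p \<le> n \<Longrightarrow>
       favard_curve_length C (four_corner_cantor n) \<le> ennreal (c / real p)"
proof -
  obtain g and p :: "nat \<Rightarrow> real" and N where N: "1 \<le> N"
    and arcs: "\<And>i. i < N \<Longrightarrow> bilipschitz_tangent_arc (p i) (p (Suc i)) g"
    and C: "C = g ` {p 0..p N}"
    using assms unfolding piecewise_bilipschitz_tangent_curve_def by blast
  have "\<forall>i\<in>{..<N}. \<exists>c. 0 \<le> c \<and> (\<forall>q m n. 1 \<le> q \<longrightarrow> saturation_level q \<le> m \<longrightarrow> 2 * m \<le> n \<longrightarrow>
      area_at_most {v. \<exists>x\<in>g ` {p i..p (Suc i)}. v + x \<in> four_corner_cantor n} (c / real q))"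
  proof
    fix i assume "i \<in> {..<N}"
    then have "bilipschitz_tangent_arc (p i) (p (Suc i)) g" using arcs by simp
    then show "\<exists>c. 0 \<le> c \<and> (\<forall>q m n. 1 \<le> q \<longrightarrow> saturation_level q \<le> m \<longrightarrow> 2 * m \<le> n \<longrightarrow>
        area_at_most {v. \<exists>x\<in>g ` {p i..p (Suc i)}. v + x \<in> four_corner_cantor n} (c / real q))"
      by (rule arc_area) blast
  qed
  from bchoice[OF this] obtain c where
    "\<forall>i\<in>{..<N}. 0 \<le> c i \<and> (\<forall>q m n. 1 \<le> q \<longrightarrow> saturation_level q \<le> m \<longrightarrow> 2 * m \<le> n \<longrightarrow>
      area_at_most {v. \<exists>x\<in>g ` {p i..p (Suc i)}. v + x \<in> four_corner_cantor n} (c i / real q))"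
    by (elim exE)
  then have c: "\<And>i. i < N \<Longrightarrow> 0 \<le> c i"
      "\<And>i q m n. i < N \<Longrightarrow> 1 \<le> q \<Longrightarrow> saturation_level q \<le> m \<Longrightarrow> 2 * m \<le> n \<Longrightarrow>
        area_at_most {v. \<exists>x\<in>g ` {p i..p (Suc i)}. v + x \<in> four_corner_cantor n} (c i / real q)"
    by simp_all
  have "p 0 < p (Suc 0)" using arcs[of 0] N by (simp add: bilipschitz_tangent_arc_def)
  then have "p 0 \<in> (\<Union>i<N. {p i..p (Suc i)})" using N by (intro UN_I[of 0]) auto
  then have pieces: "{p 0..p N} \<subseteq> (\<Union>i<N. {p i..p (Suc i)})"
    using interval_subset_pieces[of p N] by blast
  show thesis
  proof (rule that[of "\<Sum>i<N. c i"])
    show "0 \<le> (\<Sum>i<N. c i)" using c(1) by (intro sum_nonneg) auto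
    fix q n :: nat assume q: "1 \<le> q" "2 * saturation_level q \<le> n"
    let ?X = "\<lambda>i. {v. \<exists>x\<in>g ` {p i..p (Suc i)}. v + x \<in> four_corner_cantor n}"
    have "area_at_most (\<Union>i<N. ?X i) (\<Sum>i<N. c i / real q)"
      using c(1) c(2)[OF _ q(1) order_refl q(2)] by (intro area_at_most_UN) auto
    moreover have "{v. (\<lambda>x. v + x) ` C \<inter> four_corner_cantor n \<noteq> {}} \<subseteq> (\<Union>i<N. ?X i)"
      using pieces unfolding C by blast
    ultimately have "area_at_most {v. (\<lambda>x. v + x) ` C \<inter> four_corner_cantor n \<noteq> {}} (\<Sum>i<N. c i / real q)"
      by (rule area_at_most_subset)
    then obtain A where "A \<in> sets lebesgue" "{v. (\<lambda>x. v + x) ` C \<inter> four_corner_cantor n \<noteq> {}} \<subseteq> A"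
        "emeasure lebesgue A \<le> ennreal (\<Sum>i<N. c i / real q)"
      unfolding area_at_most_def by blast
    then have "favard_curve_length C (four_corner_cantor n) \<le> ennreal (\<Sum>i<N. c i / real q)"
      unfolding favard_curve_length_def using emeasure_mono order_trans by blast
    then show "favard_curve_length C (four_corner_cantor n) \<le> ennreal ((\<Sum>i<N. c i) / real q)"
      by (simp add: sum_divide_distrib)
  qed
qed

text \<open>
  With $p$ about a third of $\log_* n$, the generation $n$ exceeds the tower of height $3p+2$ and
  hence twice the saturation level.
\<close>

theorem theorem1p9:
  fixes C :: "(real \<times> real) set"
  assumes "piecewise_bilipschitz_tangent_curve C"
  shows "\<exists>(n0::nat) (c::real). 0 < c \<and>
           (\<forall>n\<ge>n0. favard_curve_length C (four_corner_cantor n)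
                      \<le> ennreal (c * real (log_star (real n)) powr (- 1 / 100)))"
proof -
  obtain c where c: "0 \<le> c" "\<And>p n. 1 \<le> p \<Longrightarrow> 2 * saturation_level p \<le> n \<Longrightarrow>
       favard_curve_length C (four_corner_cantor n) \<le> ennreal (c / real p)"
    using favard_curve_length_le_inverse[OF assms] by blast
  \<comment> \<open>The inverse tower function exceeds $20$ from here on, which makes the $p$ below at least $5$.\<close>
  obtain n0 :: nat where n0: "tower 20 < real n0" using reals_Archimedean2 by blast
  have "favard_curve_length C (four_corner_cantor n)
      \<le> ennreal ((6 * c + 1) * real (log_star (real n)) powr (- 1 / 100))" if "n0 \<le> n" for n
  proof -
    define l where "l = log_star (real n)"
    have "tower 20 < real n" using n0 that by linarith
    then have l: "20 < l" unfolding l_def by (rule log_star_gt)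
    define p where "p = (l - 3) div 3"
    have p: "5 \<le> p" "3 * p + 2 < l" "l \<le> 6 * p" using l unfolding p_def by linarith+
    have "tower (3 * p + 2) < real n"
      using log_star_le[of "real n" "3 * p + 2"] p(2) unfolding l_def by linarith
    then have "2 * saturation_level p \<le> n" using saturation_level_le_tower[OF p(1)] by linarith
    then have "favard_curve_length C (four_corner_cantor n) \<le> ennreal (c / real p)"
      using c(2) p(1) by simp
    also have "c / real p \<le> (6 * c + 1) * real l powr (- 1 / 100)"
    proof -
      have "c / real p \<le> 6 * c / real l"
      proof -
        have "real l \<le> 6 * real p" using p(3) by linarith
        then have "c * real l \<le> c * (6 * real p)" using c(1) by (rule mult_left_mono)
        then show ?thesis using p(1) l by (simp add: field_simps)
      qed
      also have "6 * c / real l = 6 * c * real l powr (- 1)"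
        using l by (simp add: powr_minus divide_inverse)
      also have "\<dots> \<le> (6 * c + 1) * real l powr (- 1 / 100)"
        using l c(1) by (intro mult_mono powr_mono) auto
      finally show ?thesis .
    qed
    finally show ?thesis unfolding l_def using ennreal_leI by blast
  qed
  then show ?thesis using c(1) by (intro exI[of _ n0] exI[of _ "6 * c + 1"]) auto
qed

end
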